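(* Let $n \in \mathbb{N}$, $n\ge 1$, $s \in (0,1)$ and $p \in [1, + \infty)$ be such that $sp > n$, and let $u \in \mathcal{S}'(\mathbb{R}^n)$. If $$d_{s} u \in L^{p}_{od}(\mathbb{R}^{2n}),$$ then $u \in C^{0,\alpha}(\mathbb{R}^{n})$ for $\alpha = s - n/p$, and $$[ u ]_{C^{0,\alpha}(\mathbb{R}^n)} \leq C \| d_s u \|_{L^{p}_{od}(\mathbb{R}^{2n})}$$ for some constant $C = C(n,s,p) > 0$.
   Context: $\mathcal{S}(\mathbb{R}^m)$ is the Fréchet space of complex-valued Schwartz functions, $\mathcal{S}'(\mathbb{R}^m)$ its topological dual (tempered distributions), and $\langle\cdot,\cdot\rangle$ the bilinear pairing; functions are identified with distributions by integration. $\mathcal{S}_{od}(\mathbb{R}^{2n})$ (off-diagonal Schwartz functions) is the set of $G \in \mathcal{S}(\mathbb{R}^{2n})$, $G = G(x,y)$ with $x,y\in\mathbb{R}^n$, such that $G(x,y) = -G(y,x)$ for all $x,y$ and $\partial_x^{\alpha}\partial_y^{\beta} G(z,z) = 0$ for all $z \in \mathbb{R}^n$ and all multi-indices $\alpha,\beta \in \mathbb{N}_0^n$; it carries the subspace topology of $\mathcal{S}(\mathbb{R}^{2n})$, and $\mathcal{S}'_{od}(\mathbb{R}^{2n})$ is its topological dual. For $s\in\mathbb{R}$ and $G \in \mathcal{S}_{od}(\mathbb{R}^{2n})$ set $\operatorname{div}_{s} G(x) := \int_{\mathbb{R}^n} \frac{2G(x,y)}{|x-y|^{s}} \frac{dy}{|x-y|^n}$;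 this defines a continuous linear map $\mathcal{S}_{od}(\mathbb{R}^{2n}) \to \mathcal{S}(\mathbb{R}^n)$. For $u \in \mathcal{S}'(\mathbb{R}^n)$ the distributional fractional gradient $d_{s}u \in \mathcal{S}'_{od}(\mathbb{R}^{2n})$ is defined by $\langle d_{s} u, G\rangle := \langle u, \operatorname{div}_{s} G\rangle$ for $G \in \mathcal{S}_{od}(\mathbb{R}^{2n})$. For $p\in[1,\infty)$, $L^p_{od}(\mathbb{R}^{2n})$ is the space of measurable functions $F$ on $\mathbb{R}^{2n}$ with $F(x,y) = -F(y,x)$ and $\|F\|_{L^p_{od}}^p := \int_{\mathbb{R}^n}\int_{\mathbb{R}^n} |F(x,y)|^p \frac{dx\,dy}{|x-y|^n} < \infty$. Such an $F$ is identified with the element of $\mathcal{S}'_{od}(\mathbb{R}^{2n})$ given by $\langle F, G\rangle := \int_{\mathbb{R}^n}\int_{\mathbb{R}^n} F(x,y) G(x,y) \frac{dx\,dy}{|x-y|^n}$; "$d_{s}u \in L^p_{od}$" means that $d_{s}u$ equals such an $F$ in $\mathcal{S}'_{od}(\mathbb{R}^{2n})$, and then $\|d_{s}u\|_{L^p_{od}} := \|F\|_{L^p_{od}}$. "$u \in C^{0,\alpha}(\mathbb{R}^n)$" means that $u$ is represented by a continuous function on $\mathbb{R}^n$ with $[u]_{C^{0,\alpha}(\mathbb{R}^n)} := \sup_{x \ne y} \frac{|u(x)-u(y)|}{|x-y|^{\alpha}} < \infty$ (no boundedness of $u$ is required). *)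

theory Defs
  imports "HOL-Analysis.Analysis"
begin

text \<open>
  Multi-indices are represented by lists of standard basis vectors: a list in which each basis
  vector \<open>b\<close> occurs \<open>\<alpha>\<^sub>b\<close> times stands for \<open>\<alpha>\<close>. For smooth functions the order of
  differentiation is irrelevant, so quantifying over such lists is quantifying over multi-indices.
\<close>

fun iter_partial ::
  "'a::euclidean_space list \<Rightarrow> ('a \<Rightarrow> 'b::real_normed_vector) \<Rightarrow> 'a \<Rightarrow> 'b" where
  "iter_partial [] f = f"
| "iter_partial (b # bs) f = (\<lambda>x. frechet_derivative (iter_partial bs f) (at x) b)"

definition monomial :: "'a::euclidean_space list \<Rightarrow> 'a \<Rightarrow> real" where
  "monomial as x = prod_list (map (\<lambda>b. x \<bullet> b) as)"

definition smooth :: "('a::euclidean_space \<Rightarrow> 'b::real_normed_vector) \<Rightarrow> bool" where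
  "smooth f \<longleftrightarrow> (\<forall>bs \<in> lists Basis. \<forall>x. iter_partial bs f differentiable (at x))"

definition schwartz :: "('a::euclidean_space \<Rightarrow> complex) set" where
  "schwartz = {f. smooth f \<and>
     (\<forall>as \<in> lists Basis. \<forall>bs \<in> lists Basis.
        bdd_above (range (\<lambda>x. \<bar>monomial as x\<bar> * norm (iter_partial bs f x))))}"

definition schwartz_seminorm ::
  "'a::euclidean_space list \<Rightarrow> 'a list \<Rightarrow> ('a \<Rightarrow> complex) \<Rightarrow> real" where
  "schwartz_seminorm as bs f = (SUP x. \<bar>monomial as x\<bar> * norm (iter_partial bs f x))"

definition schwartz_topology :: "('a::euclidean_space \<Rightarrow> complex) topology" where
  "schwartz_topology = topology_generated_by
     {{g \<in> schwartz. schwartz_seminorm as bs (\<lambda>x. g x - f x) < e} | f as bs e.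
        f \<in> schwartz \<and> as \<in> lists Basis \<and> bs \<in> lists Basis \<and> e > 0}"

text \<open>Functionals are total functions, of which only the values on \<^const>\<open>schwartz\<close> matter.\<close>

definition tempered_distribution :: "(('a::euclidean_space \<Rightarrow> complex) \<Rightarrow> complex) \<Rightarrow> bool" where
  "tempered_distribution u \<longleftrightarrow>
     (\<forall>f \<in> schwartz. \<forall>g \<in> schwartz. u (\<lambda>x. f x + g x) = u f + u g) \<and>
     (\<forall>c. \<forall>f \<in> schwartz. u (\<lambda>x. c * f x) = c * u f) \<and>
     continuous_map schwartz_topology euclidean u"

definition represented_by ::
  "(('a::euclidean_space \<Rightarrow> complex) \<Rightarrow> complex) \<Rightarrow> ('a \<Rightarrow> complex) \<Rightarrow> bool" where
  "represented_by u f \<longleftrightarrow>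
     (\<forall>\<phi> \<in> schwartz. integrable lebesgue (\<lambda>x. f x * \<phi> x) \<and>
        u \<phi> = integral\<^sup>L lebesgue (\<lambda>x. f x * \<phi> x))"

definition schwartz_od :: "('a::euclidean_space \<times> 'a \<Rightarrow> complex) set" where
  "schwartz_od = {G \<in> schwartz.
     (\<forall>x y. G (x, y) = - G (y, x)) \<and>
     (\<forall>bs \<in> lists Basis. \<forall>z. iter_partial bs G (z, z) = 0)}"

definition frac_div ::
  "real \<Rightarrow> ('a::euclidean_space \<times> 'a \<Rightarrow> complex) \<Rightarrow> 'a \<Rightarrow> complex" where
  "frac_div s G x = integral\<^sup>L lebesgue
     (\<lambda>y. 2 * G (x, y) / of_real (norm (x - y) powr s) / of_real (norm (x - y) ^ DIM('a)))"

definition frac_grad ::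
  "real \<Rightarrow> (('a::euclidean_space \<Rightarrow> complex) \<Rightarrow> complex) \<Rightarrow>
     ('a \<times> 'a \<Rightarrow> complex) \<Rightarrow> complex" where
  "frac_grad s u G = u (frac_div s G)"

text \<open>
  As usual for \<open>L\<^sup>p\<close>, functions are considered up to null sets, so antisymmetry is
  required almost everywhere.
\<close>

definition Lp_od :: "real \<Rightarrow> ('a::euclidean_space \<times> 'a \<Rightarrow> complex) set" where
  "Lp_od p = {F \<in> borel_measurable lebesgue.
     (AE z in lebesgue. F z = - F (prod.swap z)) \<and>
     integrable lebesgue (\<lambda>(x, y). norm (F (x, y)) powr p / norm (x - y) ^ DIM('a))}"

definition Lp_od_norm :: "real \<Rightarrow> ('a::euclidean_space \<times> 'a \<Rightarrow> complex) \<Rightarrow> real" where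
  "Lp_od_norm p F =
     (integral\<^sup>L lebesgue (\<lambda>(x, y). norm (F (x, y)) powr p / norm (x - y) ^ DIM('a)))
       powr (1 / p)"

definition od_pairing ::
  "('a::euclidean_space \<times> 'a \<Rightarrow> complex) \<Rightarrow> ('a \<times> 'a \<Rightarrow> complex) \<Rightarrow> complex" where
  "od_pairing F G =
     integral\<^sup>L lebesgue (\<lambda>(x, y). F (x, y) * G (x, y) / of_real (norm (x - y) ^ DIM('a)))"

definition od_represented_by ::
  "(('a::euclidean_space \<times> 'a \<Rightarrow> complex) \<Rightarrow> complex) \<Rightarrow> ('a \<times> 'a \<Rightarrow> complex) \<Rightarrow> bool" where
  "od_represented_by T F \<longleftrightarrow> (\<forall>G \<in> schwartz_od. T G = od_pairing F G)"

definition holder_quotients ::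
  "real \<Rightarrow> ('a::euclidean_space \<Rightarrow> complex) \<Rightarrow> real set" where
  "holder_quotients \<alpha> f = {norm (f x - f y) / norm (x - y) powr \<alpha> | x y. x \<noteq> y}"

definition holder_continuous :: "real \<Rightarrow> ('a::euclidean_space \<Rightarrow> complex) \<Rightarrow> bool" where
  "holder_continuous \<alpha> f \<longleftrightarrow> continuous_on UNIV f \<and> bdd_above (holder_quotients \<alpha> f)"

definition holder_seminorm :: "real \<Rightarrow> ('a::euclidean_space \<Rightarrow> complex) \<Rightarrow> real" where
  "holder_seminorm \<alpha> f = Sup (holder_quotients \<alpha> f)"

lemma iter_partial_zero: "iter_partial bs (\<lambda>x. 0) = (\<lambda>x. 0)"
  by (induction bs) auto

lemma topspace_schwartz_topology: 
  "topspace schwartz_topology = (schwartz :: ('a::euclidean_space \<Rightarrow> complex) set)"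
proof -
  define B :: "('a \<Rightarrow> complex) \<Rightarrow> 'a list \<Rightarrow> 'a list \<Rightarrow> real \<Rightarrow> ('a \<Rightarrow> complex) set"
    where "B = (\<lambda>f as bs e. {g \<in> schwartz. schwartz_seminorm as bs (\<lambda>x. g x - f x) < e})"
  have top: "topspace schwartz_topology = \<Union> {B f as bs e | f as bs e.
        f \<in> schwartz \<and> as \<in> lists Basis \<and> bs \<in> lists Basis \<and> e > 0}"
    unfolding schwartz_topology_def B_def by (rule topology_generated_by_topspace)
  have "f \<in> B f [] [] 1" if "f \<in> schwartz" for f
    using that by (simp add: B_def schwartz_seminorm_def iter_partial_zero)
  moreover have "([] :: 'a list) \<in> lists Basis" "(1::real) > 0" by auto
  ultimately have "(schwartz :: ('a \<Rightarrow> complex) set) \<subseteq> topspace schwartz_topology"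
    unfolding top by blast
  moreover have "topspace schwartz_topology \<subseteq> (schwartz :: ('a \<Rightarrow> complex) set)"
    unfolding top by (auto simp: B_def)
  ultimately show ?thesis by blast
qed

end

theory Submission
  imports Defs
begin

text \<open>
  Let \<open>a\<close> and \<open>b\<close> be smooth with disjoint compact supports. The function
  \<open>\<bar>x - y\<bar>\<^sup>s\<^sup>+\<^sup>n (a(x) b(y) - a(y) b(x)) / 2\<close> vanishes near the diagonal, so it is an off-diagonal
  Schwartz function, and its weight cancels the kernel of the fractional divergence: the divergence
  is \<open>(\<integral>b) a - (\<integral>a) b\<close>. If \<open>a\<close> and \<open>b\<close> have integral one, then \<open>u(a) - u(b)\<close> is therefore the
  pairing of \<open>F\<close> with this function (\<open>two_bump_identity\<close>). When both live in cubes of size \<open>r\<close>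
  whose distance is comparable to \<open>r\<close>, an inequality of Hoelder type bounds the pairing by
  \<open>C r\<^sup>\<alpha> \<parallel>F\<parallel>\<close> (\<open>two_bump_estimate\<close>).

  Thus the average of \<open>u\<close> against a bump of unit mass at scale \<open>r\<close> changes by \<open>O(r\<^sup>\<alpha> \<parallel>F\<parallel>)\<close> when the
  bump moves by a distance comparable to \<open>r\<close>. Passing through a distant bump, the same is true when
  the bump stays where it is and shrinks by a factor of at most two. As \<open>\<alpha> > 0\<close>, summing a
  geometric series shows that the averages around \<open>c\<close> converge to a number \<open>f(c)\<close>, with error
  \<open>O(r\<^sup>\<alpha> \<parallel>F\<parallel>)\<close> at scale \<open>r\<close> (\<open>average_near_value\<close>). Comparing \<open>f(x)\<close> and \<open>f(y)\<close> with averages at a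
  scale comparable to \<open>\<bar>x - y\<bar>\<close> gives the Hoelder estimate (\<open>holder_bound\<close>).

  To see that \<open>u\<close> is integration against \<open>f\<close>, cut a test function \<open>\<phi>\<close> of compact support by a smooth
  partition of unity into \<open>O(r\<^sup>-\<^sup>n)\<close> pieces supported in cubes of size \<open>r\<close>. On each piece \<open>\<psi>\<close>, the
  two-bump estimate replaces \<open>u(\<psi>)\<close> by the value of \<open>f\<close> at the centre times \<open>\<integral>\<psi>\<close>, and the Hoelder
  continuity of \<open>f\<close> replaces that by \<open>\<integral>f \<psi>\<close>; both errors are \<open>O(r\<^sup>n\<^sup>+\<^sup>\<alpha>)\<close> (\<open>cell_error\<close>), so the
  total error is \<open>O(r\<^sup>\<alpha>)\<close> and tends to zero with \<open>r\<close>. For a general Schwartz function, cut-offs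
  converge in the Schwartz topology and in the integral
  (\<open>tempered_distribution_cutoff_tendsto\<close>, \<open>integral_cutoff_tendsto\<close>).
\<close>

section \<open>Smooth functions\<close>

lemma iter_partial_append: "iter_partial (bs @ cs) f = iter_partial bs (iter_partial cs f)"
  by (induction bs) auto

lemma smooth_iter_partial:
  assumes "smooth f" "cs \<in> lists Basis"
  shows "smooth (iter_partial cs f)"
  using assms by (auto simp: smooth_def iter_partial_append[symmetric])

lemma smooth_partial:
  assumes "smooth f" "b \<in> Basis"
  shows "smooth (\<lambda>x. frechet_derivative f (at x) b)"
  using smooth_iter_partial[of f "[b]"] assms by simp

lemma smooth_differentiable: "smooth f \<Longrightarrow> f differentiable (at x)"
  unfolding smooth_def by (metis iter_partial.simps(1) lists.Nil)

lemma smooth_has_derivative: "smooth f \<Longrightarrow> (f has_derivative frechet_derivative f (at x)) (at x)"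
  using smooth_differentiable frechet_derivative_works by blast

lemma smooth_continuous_on: "smooth f \<Longrightarrow> continuous_on A f"
  using smooth_differentiable[of f] differentiable_imp_continuous_within
  by (metis continuous_at_imp_continuous_on)

inductive_set finite_sums :: "('a \<Rightarrow> 'b::real_normed_vector) set \<Rightarrow> ('a \<Rightarrow> 'b) set"
  for S :: "('a \<Rightarrow> 'b) set" where
  zero: "(\<lambda>x. 0) \<in> finite_sums S"
| base: "f \<in> S \<Longrightarrow> f \<in> finite_sums S"
| add: "f \<in> finite_sums S \<Longrightarrow> g \<in> finite_sums S \<Longrightarrow> (\<lambda>x. f x + g x) \<in> finite_sums S"

lemma finite_sums_sum:
  assumes "finite A" "\<And>i. i \<in> A \<Longrightarrow> f i \<in> finite_sums S"
  shows "(\<lambda>x. \<Sum>i\<in>A. f i x) \<in> finite_sums S"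
  using assms by (induction A) (auto intro: finite_sums.intros)

text \<open>
  Higher partial derivatives of composite expressions have no manageable closed form. A family that
  reproduces itself, up to finite sums, under one differentiation avoids them: every rule of
  calculus below reduces to naming such a family and differentiating its members once.
\<close>

lemma smooth_by_family:
  fixes f :: "'a::euclidean_space \<Rightarrow> 'b::real_normed_vector"
  assumes family: "\<And>f. f \<in> S \<Longrightarrow> \<exists>D. (\<forall>x. (f has_derivative D x) (at x)) \<and>
            (\<forall>b\<in>Basis. (\<lambda>x. D x b) \<in> finite_sums S)"
    and "f \<in> S"
  shows "smooth f"
proof -
  have step: "\<exists>D. (\<forall>x. (f has_derivative D x) (at x)) \<and> (\<forall>b\<in>Basis. (\<lambda>x. D x b) \<in> finite_sums S)"
    if "f \<in> finite_sums S" for f :: "'a \<Rightarrow> 'b"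
    using that
  proof induction
    case zero
    have "((\<lambda>x. 0) has_derivative (\<lambda>_. 0::'b)) (at x)" for x :: 'a by simp
    then show ?case using finite_sums.zero by (intro exI[of _ "\<lambda>x v. 0"]) auto
  next
    case (base f)
    then show ?case using family by blast
  next
    case (add f g)
    then obtain D E where *: "\<forall>x. (f has_derivative D x) (at x)" "\<forall>b\<in>Basis. (\<lambda>x. D x b) \<in> finite_sums S"
       "\<forall>x. (g has_derivative E x) (at x)" "\<forall>b\<in>Basis. (\<lambda>x. E x b) \<in> finite_sums S" by blast
    show ?case
      by (rule exI[of _ "\<lambda>x v. D x v + E x v"]) (use * in \<open>auto intro: has_derivative_add finite_sums.add\<close>)
  qed
  have mem: "iter_partial bs f \<in> finite_sums S" if "bs \<in> lists Basis" for bs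
    using that
  proof (induction bs)
    case Nil
    then show ?case using assms finite_sums.base by simp
  next
    case (Cons b bs)
    then obtain D where *: "\<forall>x. (iter_partial bs f has_derivative D x) (at x)"
      "\<forall>b\<in>Basis. (\<lambda>x. D x b) \<in> finite_sums S" using step[of "iter_partial bs f"] by auto
    then have "frechet_derivative (iter_partial bs f) (at x) = D x" for x
      using frechet_derivative_at by metis
    with * Cons show ?case by auto
  qed
  show ?thesis unfolding smooth_def
    using step[OF mem] differentiable_def by blast
qed

lemma smooth_family_real:
  fixes f :: "real \<Rightarrow> real"
  assumes "\<And>f. f \<in> S \<Longrightarrow> \<exists>D \<in> finite_sums S. \<forall>x. (f has_real_derivative D x) (at x)"
    and "f \<in> S"
  shows "smooth f"
proof (rule smooth_by_family[OF _ assms(2)])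
  fix f assume "f \<in> S"
  then obtain D where "D \<in> finite_sums S" "\<forall>x. (f has_real_derivative D x) (at x)"
    using assms(1) by blast
  then show "\<exists>D. (\<forall>x. (f has_derivative D x) (at x)) \<and>
            (\<forall>b\<in>Basis. (\<lambda>x. D x b) \<in> finite_sums S)"
    by (intro exI[of _ "\<lambda>x. (*) (D x)"]) (auto simp: has_field_derivative_def)
qed

lemma frechet_derivative_add:
  assumes "f differentiable at x" "g differentiable at x"
  shows "frechet_derivative (\<lambda>x. f x + g x) (at x) b = frechet_derivative f (at x) b + frechet_derivative g (at x) b"
proof -
  have "((\<lambda>x. f x + g x) has_derivative (\<lambda>b. frechet_derivative f (at x) b + frechet_derivative g (at x) b)) (at x)"
    by (intro has_derivative_add) (use assms frechet_derivative_works in auto)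
  then show ?thesis using frechet_derivative_at by metis
qed

lemma iter_partial_add:
  assumes "smooth f" "smooth g" "bs \<in> lists Basis"
  shows "iter_partial bs (\<lambda>x. f x + g x) = (\<lambda>x. iter_partial bs f x + iter_partial bs g x)"
  using assms(3)
proof (induction bs)
  case (Cons b bs)
  then show ?case
    using assms by (auto simp: smooth_def intro!: ext frechet_derivative_add)
qed auto

lemma smooth_add: 
  assumes "smooth f" "smooth g"
  shows "smooth (\<lambda>x. f x + g x)"
  using assms unfolding smooth_def by (simp add: iter_partial_add[OF assms])

lemma smooth_const [simp, intro]: "smooth (\<lambda>x. c)"
proof (rule smooth_by_family[where S = "range (\<lambda>c x. c)"])
  fix f :: "'a \<Rightarrow> 'b" assume "f \<in> range (\<lambda>c x. c)"
  then show "\<exists>D. (\<forall>x. (f has_derivative D x) (at x)) \<and>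
            (\<forall>b\<in>Basis. (\<lambda>x. D x b) \<in> finite_sums (range (\<lambda>c x. c)))"
    by (auto intro!: exI[of _ "\<lambda>x v. 0"] finite_sums.zero)
qed auto

lemma smooth_bounded_linear:
  assumes "bounded_linear L"
  shows "smooth L"
proof (rule smooth_by_family[where S = "insert L (range (\<lambda>c x. c))"])
  fix f assume "f \<in> insert L (range (\<lambda>c x. c))"
  then consider "f = L" | c where "f = (\<lambda>x. c)" by auto
  then show "\<exists>D. (\<forall>x. (f has_derivative D x) (at x)) \<and>
            (\<forall>b\<in>Basis. (\<lambda>x. D x b) \<in> finite_sums (insert L (range (\<lambda>c x. c))))"
  proof cases
    case 1
    then show ?thesis
      by (intro exI[of _ "\<lambda>x. L"]) (auto intro!: finite_sums.base bounded_linear_imp_has_derivative assms)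
  next
    case 2
    then show ?thesis
      by (auto intro!: exI[of _ "\<lambda>x v. 0"] finite_sums.zero)
  qed
qed auto

lemma smooth_scaleR:
  fixes h :: "'a::euclidean_space \<Rightarrow> real" and g :: "'a \<Rightarrow> 'b::real_normed_vector"
  assumes "smooth h" "smooth g"
  shows "smooth (\<lambda>x. h x *\<^sub>R g x)"
proof -
  define S where "S = {\<lambda>x. h x *\<^sub>R g x | (h :: 'a \<Rightarrow> real) (g :: 'a \<Rightarrow> 'b). smooth h \<and> smooth g}"
  have SI: "(\<lambda>x. h x *\<^sub>R g x) \<in> S" if "smooth h" "smooth g" for h g
    unfolding S_def by (rule CollectI, rule exI[of _ h], rule exI[of _ g]) (simp add: that)
  show ?thesis
  proof (rule smooth_by_family[where S = S])
    fix f :: "'a \<Rightarrow> 'b" assume "f \<in> S"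
    then obtain h g where f: "f = (\<lambda>x. h x *\<^sub>R g x)" and hg: "smooth h" "smooth g"
      unfolding S_def by blast
    let ?D = "\<lambda>x v. h x *\<^sub>R frechet_derivative g (at x) v + frechet_derivative h (at x) v *\<^sub>R g x"
    have "(f has_derivative ?D x) (at x)" for x
      unfolding f by (intro has_derivative_scaleR smooth_has_derivative hg)
    moreover have "(\<lambda>x. ?D x b) \<in> finite_sums S" if "b \<in> Basis" for b
      by (rule finite_sums.add; rule finite_sums.base; rule SI) (simp_all add: hg smooth_partial that)
    ultimately show "\<exists>D. (\<forall>x. (f has_derivative D x) (at x)) \<and>
         (\<forall>b\<in>Basis. (\<lambda>x. D x b) \<in> finite_sums S)"
      by (intro exI[of _ ?D]) simp
  qed (rule SI[OF assms])
qed

lemma smooth_mult: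
  fixes h g :: "'a::euclidean_space \<Rightarrow> real"
  assumes "smooth h" "smooth g"
  shows "smooth (\<lambda>x. h x * g x)"
  using smooth_scaleR[OF assms] by simp

lemma smooth_sum:
  assumes "\<And>i. i \<in> A \<Longrightarrow> smooth (f i)"
  shows "smooth (\<lambda>x. \<Sum>i\<in>A. f i x)"
  using assms by (induction A rule: infinite_finite_induct) (auto intro: smooth_add)

lemma smooth_prod:
  fixes f :: "'i \<Rightarrow> 'a::euclidean_space \<Rightarrow> real"
  assumes "\<And>i. i \<in> A \<Longrightarrow> smooth (f i)"
  shows "smooth (\<lambda>x. \<Prod>i\<in>A. f i x)"
  using assms by (induction A rule: infinite_finite_induct) (auto intro: smooth_mult)

lemma smooth_cmult:
  fixes g :: "'a::euclidean_space \<Rightarrow> 'b::real_normed_vector"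
  shows "smooth g \<Longrightarrow> smooth (\<lambda>x. c *\<^sub>R g x)"
  using smooth_scaleR[of "\<lambda>x. c" g] by simp

lemma smooth_diff:
  assumes "smooth f" "smooth g"
  shows "smooth (\<lambda>x. f x - g x)"
  using smooth_add[OF assms(1) smooth_cmult[OF assms(2), of "-1"]] by simp

lemma smooth_inner_left:
  fixes g :: "'a::euclidean_space \<Rightarrow> 'b::euclidean_space"
  assumes "smooth g"
  shows "smooth (\<lambda>x. g x \<bullet> c)"
proof -
  define S where "S = {\<lambda>x. g x \<bullet> c | g :: 'a \<Rightarrow> 'b. smooth g}"
  have SI: "(\<lambda>x. g x \<bullet> c) \<in> S" if "smooth g" for g
    unfolding S_def by (rule CollectI, rule exI[of _ g]) (simp add: that)
  show ?thesis
  proof (rule smooth_by_family[where S = S])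
    fix f :: "'a \<Rightarrow> real" assume "f \<in> S"
    then obtain g where f: "f = (\<lambda>x. g x \<bullet> c)" and g: "smooth g"
      unfolding S_def by blast
    have "(f has_derivative (\<lambda>v. frechet_derivative g (at x) v \<bullet> c)) (at x)" for x
      unfolding f by (intro has_derivative_inner_left smooth_has_derivative g)
    moreover have "(\<lambda>x. frechet_derivative g (at x) b \<bullet> c) \<in> finite_sums S"
      if "b \<in> Basis" for b
      by (rule finite_sums.base, rule SI, rule smooth_partial[OF g that])
    ultimately show "\<exists>D. (\<forall>x. (f has_derivative D x) (at x)) \<and>
       (\<forall>b\<in>Basis. (\<lambda>x. D x b) \<in> finite_sums S)"
      by (intro exI[of _ "\<lambda>x v. frechet_derivative g (at x) v \<bullet> c"]) simp
  qed (rule SI[OF assms])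
qed

text \<open>
  The family consists of the products of \<open>g \<circ> q\<close> with a smooth scalar factor, where \<open>g\<close> varies as
  well: the chain rule replaces \<open>g\<close> by its partial derivatives and moves those of \<open>q\<close> into the factor.
\<close>

lemma smooth_compose:
  fixes q :: "'a::euclidean_space \<Rightarrow> 'b::euclidean_space" and g :: "'b \<Rightarrow> 'c::real_normed_vector"
  assumes g: "smooth g" and q: "smooth q"
  shows "smooth (\<lambda>x. g (q x))"
proof -
  define S where "S = {\<lambda>x. h x *\<^sub>R g (q x) | (h :: 'a \<Rightarrow> real) (g :: 'b \<Rightarrow> 'c). smooth h \<and> smooth g}"
  have SI: "(\<lambda>x. h x *\<^sub>R g (q x)) \<in> S" if "smooth h" "smooth g" for h g
    unfolding S_def by (rule CollectI, rule exI[of _ h], rule exI[of _ g]) (simp add: that)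
  have "smooth (\<lambda>x. 1 *\<^sub>R g (q x))"
  proof (rule smooth_by_family[where S = S])
    fix f assume "f \<in> S"
    then obtain h g where f: "f = (\<lambda>x. h x *\<^sub>R g (q x))" and hg: "smooth h" "smooth g"
      unfolding S_def by blast
    let ?D = "\<lambda>x v. h x *\<^sub>R frechet_derivative g (at (q x)) (frechet_derivative q (at x) v) +
                 frechet_derivative h (at x) v *\<^sub>R g (q x)"
    have "(f has_derivative ?D x) (at x)" for x
      unfolding f 
      by (intro has_derivative_scaleR smooth_has_derivative hg
          has_derivative_compose[OF smooth_has_derivative smooth_has_derivative] q)
    moreover have "(\<lambda>x. ?D x b) \<in> finite_sums S" if b: "b \<in> Basis" for b
    proof -
      have lin: "linear (frechet_derivative g (at y))" for y
        using smooth_has_derivative[OF hg(2)] has_derivative_linear by blast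
      have expand: "frechet_derivative g (at (q x)) v = (\<Sum>c\<in>Basis. (v \<bullet> c) *\<^sub>R frechet_derivative g (at (q x)) c)" for x v
        using linear_sum[OF lin, of "q x" "\<lambda>c. (v \<bullet> c) *\<^sub>R c" Basis]
        by (simp add: linear_cmul[OF lin] euclidean_representation)
      have "(\<lambda>x. ?D x b) = (\<lambda>x. (\<Sum>c\<in>Basis. (h x * (frechet_derivative q (at x) b \<bullet> c)) *\<^sub>R frechet_derivative g (at (q x)) c) +
          frechet_derivative h (at x) b *\<^sub>R g (q x))"
        by (subst expand) (simp only: scaleR_sum_right scaleR_scaleR)
      moreover have "(\<lambda>x. frechet_derivative h (at x) b *\<^sub>R g (q x)) \<in> S"
        by (rule SI[OF smooth_partial[OF hg(1) b] hg(2)])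
      moreover have "(\<lambda>x. (h x * (frechet_derivative q (at x) b \<bullet> c)) *\<^sub>R frechet_derivative g (at (q x)) c) \<in> S"
        if "c \<in> Basis" for c
      proof -
        have "smooth (\<lambda>x. h x * (frechet_derivative q (at x) b \<bullet> c))"
          by (intro smooth_mult hg smooth_inner_left smooth_partial q b)
        from SI[OF this smooth_partial[OF hg(2) that]] show ?thesis .
      qed
      ultimately show ?thesis
        by (simp only:) (rule finite_sums.add[OF finite_sums_sum finite_sums.base]; simp add: finite_sums.base)
    qed
    ultimately show "\<exists>D. (\<forall>x. (f has_derivative D x) (at x)) \<and> (\<forall>b\<in>Basis. (\<lambda>x. D x b) \<in> finite_sums S)"
      by (intro exI[of _ ?D]) simp
  next
    show "(\<lambda>x. 1 *\<^sub>R g (q x)) \<in> S" by (rule SI[OF smooth_const g])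
  qed
  then show ?thesis by simp
qed

lemma frechet_derivative_eq_0_on_open:
  fixes f :: "'a::euclidean_space \<Rightarrow> 'b::real_normed_vector"
  assumes "open U" "\<And>x. x \<in> U \<Longrightarrow> f x = 0" "x \<in> U"
  shows "frechet_derivative f (at x) b = 0" "(f has_derivative (\<lambda>_. 0)) (at x)"
proof -
  show "(f has_derivative (\<lambda>_. 0)) (at x)"
    by (rule has_derivative_transform_within_open[OF has_derivative_const assms(1,3)])
       (use assms(2) in auto)
  then show "frechet_derivative f (at x) b = 0" using frechet_derivative_at by metis
qed

lemma iter_partial_eq_0_on_open:
  fixes f :: "'a::euclidean_space \<Rightarrow> 'b::real_normed_vector"
  assumes "open U" "\<And>x. x \<in> U \<Longrightarrow> f x = 0" "x \<in> U"
  shows "iter_partial bs f x = 0"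
  using assms(3)
proof (induction bs arbitrary: x)
  case (Cons b bs)
  then show ?case
    using frechet_derivative_eq_0_on_open(1)[OF assms(1), of "iter_partial bs f"] by auto
qed (use assms in auto)

text \<open>
  A power of \<open>D\<close> can be differentiated only where \<open>D\<close> is positive. The closed set \<open>K\<close> keeps \<open>g\<close> away
  from the other points: outside \<open>K\<close> the product is zero on an open set, and so are all its
  derivatives. The exponent varies in the family, because differentiation lowers it.
\<close>

lemma smooth_powr_scaleR:
  fixes D :: "'a::euclidean_space \<Rightarrow> real" and g :: "'a \<Rightarrow> 'b::real_normed_vector"
  assumes D: "smooth D" and g: "smooth g" and K: "closed K" "\<And>x. x \<in> K \<Longrightarrow> D x > 0"
    and gK: "\<And>x. x \<notin> K \<Longrightarrow> g x = 0"
  shows "smooth (\<lambda>x. (D x powr \<gamma>) *\<^sub>R g x)"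
proof -
  define S where "S = {\<lambda>x. (D x powr \<gamma>) *\<^sub>R g x | \<gamma> (g :: 'a \<Rightarrow> 'b). smooth g \<and> (\<forall>x. x \<notin> K \<longrightarrow> g x = 0)}"
  have SI: "(\<lambda>x. (D x powr \<gamma>) *\<^sub>R g x) \<in> S" if "smooth g" "\<And>x. x \<notin> K \<Longrightarrow> g x = 0" for \<gamma> g
    unfolding S_def by (rule CollectI, rule exI[of _ \<gamma>], rule exI[of _ g]) (simp add: that)
  show ?thesis
  proof (rule smooth_by_family[where S = S])
    fix f assume "f \<in> S"
    then obtain \<gamma> g where f: "f = (\<lambda>x. (D x powr \<gamma>) *\<^sub>R g x)" and g: "smooth g"
      and gK: "\<And>x. x \<notin> K \<Longrightarrow> g x = 0"
      unfolding S_def by blast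
    let ?E = "\<lambda>x v. (D x powr \<gamma>) *\<^sub>R frechet_derivative g (at x) v +
                 (D x powr (\<gamma> - 1)) *\<^sub>R ((\<gamma> * frechet_derivative D (at x) v) *\<^sub>R g x)"
    have gK': "frechet_derivative g (at x) b = 0" if "x \<notin> K" for x b
      by (rule frechet_derivative_eq_0_on_open(1)[of "- K"]) (use that gK K in auto)
    have "(f has_derivative ?E x) (at x)" for x
    proof (cases "x \<in> K")
      case True
      have "((\<lambda>t. t powr \<gamma>) has_real_derivative \<gamma> * D x powr (\<gamma> - 1)) (at (D x))"
        using K(2)[OF True] by (rule has_real_derivative_powr)
      then have "((\<lambda>t. t powr \<gamma>) has_derivative (*) (\<gamma> * D x powr (\<gamma> - 1))) (at (D x))"
        by (simp add: has_field_derivative_def)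
      from has_derivative_scaleR[OF has_derivative_compose[OF smooth_has_derivative[OF D] this] smooth_has_derivative[OF g]]
      have "(f has_derivative (\<lambda>v. (D x powr \<gamma>) *\<^sub>R frechet_derivative g (at x) v +
         (\<gamma> * D x powr (\<gamma> - 1) * frechet_derivative D (at x) v) *\<^sub>R g x)) (at x)"
        unfolding f .
      then show ?thesis by (simp add: mult_ac)
    next
      case False
      have "(f has_derivative (\<lambda>_. 0)) (at x)"
        by (rule frechet_derivative_eq_0_on_open(2)[of "- K"]) (use False gK K f in auto)
      then show ?thesis using False gK gK' by simp
    qed
    moreover have "(\<lambda>x. ?E x b) \<in> finite_sums S" if b: "b \<in> Basis" for b
    proof -
      have "(\<lambda>x. (D x powr \<gamma>) *\<^sub>R frechet_derivative g (at x) b) \<in> S"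
        by (rule SI) (simp_all add: smooth_partial[OF g b] gK')
      moreover have "(\<lambda>x. (D x powr (\<gamma> - 1)) *\<^sub>R ((\<gamma> * frechet_derivative D (at x) b) *\<^sub>R g x)) \<in> S"
        by (rule SI[where g = "\<lambda>x. (\<gamma> * frechet_derivative D (at x) b) *\<^sub>R g x"])
           (simp_all add: smooth_scaleR smooth_mult smooth_partial D g b gK)
      ultimately show ?thesis by (intro finite_sums.add finite_sums.base)
    qed
    ultimately show "\<exists>D. (\<forall>x. (f has_derivative D x) (at x)) \<and> (\<forall>b\<in>Basis. (\<lambda>x. D x b) \<in> finite_sums S)"
      by (intro exI[of _ ?E]) simp
  qed (rule SI[OF g gK])
qed

lemma smooth_of_real:
  fixes h :: "'a::euclidean_space \<Rightarrow> real"
  assumes "smooth h"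
  shows "smooth (\<lambda>x. complex_of_real (h x))"
  using smooth_scaleR[OF assms smooth_const[of "1::complex"]] by (simp add: scaleR_conv_of_real)

section \<open>Smooth steps and bumps\<close>

text \<open>
  These are the functions \<open>t\<^sup>-\<^sup>k exp(-1/t)\<close>, continued by zero. The powers of \<open>t\<close> are there because
  differentiating \<open>exp(-1/t)\<close> produces them.
\<close>

definition flat :: "nat \<Rightarrow> real \<Rightarrow> real" where
  "flat k t = (if t > 0 then (1 / t) ^ k * exp (- (1 / t)) else 0)"

lemma flat_has_derivative:
  "(flat k has_real_derivative flat (k + 2) t - real k * flat (k + 1) t) (at t)"
proof -
  consider "t > 0" | "t < 0" | "t = 0" by linarith
  then show ?thesis
  proof cases
    case 1
    have w: "((\<lambda>t. 1 / t) has_real_derivative - ((1 / t) ^ 2)) (at t)"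
      using 1 by (auto intro!: derivative_eq_intros simp: power2_eq_square)
    have "((\<lambda>t. (1 / t) ^ k * exp (- (1 / t))) has_real_derivative
        real k * ((1 / t) ^ (k - 1) * (- ((1 / t) ^ 2))) * exp (- (1 / t)) +
        (1 / t) ^ k * (exp (- (1 / t)) * (1 / t) ^ 2)) (at t)"
      by (rule derivative_eq_intros w refl)+ simp
    also have "real k * ((1 / t) ^ (k - 1) * (- ((1 / t) ^ 2))) * exp (- (1 / t)) +
        (1 / t) ^ k * (exp (- (1 / t)) * (1 / t) ^ 2) = flat (k + 2) t - real k * flat (k + 1) t"
      using 1 by (cases k) (simp_all add: flat_def power2_eq_square del: power_divide power_one_over)
    finally have "((\<lambda>t. (1 / t) ^ k * exp (- (1 / t))) has_real_derivative
        flat (k + 2) t - real k * flat (k + 1) t) (at t)" .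
    then show ?thesis
      by (rule has_field_derivative_transform_within_open[where S = "{0<..}"]) (use 1 in \<open>auto simp: flat_def\<close>)
  next
    case 2
    have "((\<lambda>t. 0) has_real_derivative 0) (at t)" by simp
    then have "(flat k has_real_derivative 0) (at t)"
      by (rule has_field_derivative_transform_within_open[where S = "{..<0}"]) (use 2 in \<open>auto simp: flat_def\<close>)
    then show ?thesis using 2 by (simp add: flat_def)
  next
    case 3
    \<comment> \<open>At the origin the difference quotient tends to zero, as the exponential beats every power.\<close>
    have "((\<lambda>y. flat k y / y) \<longlongrightarrow> 0) (at_left 0)"
      by (rule tendsto_eventually) (auto simp: eventually_at_filter flat_def)
    moreover have "((\<lambda>y. flat k y / y) \<longlongrightarrow> 0) (at_right 0)"
    proof -
      have "((\<lambda>y. inverse y ^ (k + 1) / exp (inverse y)) \<longlongrightarrow> (0::real)) (at_right 0)"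
        by (rule filterlim_compose[OF tendsto_power_div_exp_0 filterlim_inverse_at_top_right])
      then show ?thesis
        by (rule Lim_transform_eventually)
           (auto simp: eventually_at_filter flat_def field_simps exp_minus)
    qed
    ultimately have "((\<lambda>y. flat k y / y) \<longlongrightarrow> 0) (at 0)"
      by (simp add: filterlim_split_at)
    then show ?thesis using 3 by (simp add: has_field_derivative_iff flat_def)
  qed
qed

lemma smooth_flat: "smooth (flat k)"
proof -
  define S where "S = {\<lambda>t. c * flat k t | c k. True}"
  have SI: "(\<lambda>t. c * flat k t) \<in> S" for c k unfolding S_def by blast
  have "smooth (\<lambda>t. 1 * flat k t)"
  proof (rule smooth_family_real[where S = S])
    fix f assume "f \<in> S"
    then obtain c k where f: "f = (\<lambda>t. c * flat k t)" unfolding S_def by blast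
    have "(f has_real_derivative c * flat (k + 2) t + (- c * real k) * flat (k + 1) t) (at t)" for t
      unfolding f by (rule DERIV_cong[OF DERIV_cmult[OF flat_has_derivative]]) (simp add: algebra_simps)
    moreover have "(\<lambda>t. c * flat (k + 2) t + (- c * real k) * flat (k + 1) t) \<in> finite_sums S"
      by (rule finite_sums.add; rule finite_sums.base; rule SI)
    ultimately show "\<exists>D\<in>finite_sums S. \<forall>x. (f has_real_derivative D x) (at x)"
      by (intro bexI[of _ "\<lambda>t. c * flat (k + 2) t + (- c * real k) * flat (k + 1) t"] allI)
  qed (rule SI)
  then show ?thesis by simp
qed

definition smooth_step :: "real \<Rightarrow> real" where
  "smooth_step t = flat 0 t / (flat 0 t + flat 0 (1 - t))"

lemma flat0_nonneg: "flat 0 t \<ge> 0" and flat0_pos_iff: "flat 0 t > 0 \<longleftrightarrow> t > 0"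
  and flat0_eq_0_iff: "flat 0 t = 0 \<longleftrightarrow> t \<le> 0"
  by (auto simp: flat_def)

lemma step_denominator_pos: "flat 0 t + flat 0 (1 - t) > 0"
  using flat0_nonneg[of t] flat0_nonneg[of "1 - t"] flat0_pos_iff[of t] flat0_pos_iff[of "1 - t"]
  by linarith

lemma smooth_affine_real: "smooth (\<lambda>t::real. a + b * t)"
  by (intro smooth_add smooth_const smooth_bounded_linear bounded_linear_mult_right)

lemma smooth_smooth_step: "smooth smooth_step"
proof -
  have 1: "smooth (\<lambda>t. flat 0 (1 - t))"
    using smooth_compose[OF smooth_flat smooth_affine_real[of 1 "-1"], of 0] by simp
  have "smooth (\<lambda>t. ((flat 0 t + flat 0 (1 - t)) powr (-1)) *\<^sub>R flat 0 t)"
    by (rule smooth_powr_scaleR[where K = UNIV]) (auto intro: smooth_add smooth_flat 1 step_denominator_pos)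
  also have "(\<lambda>t. ((flat 0 t + flat 0 (1 - t)) powr (-1)) *\<^sub>R flat 0 t) = smooth_step"
    using step_denominator_pos by (auto simp: smooth_step_def powr_minus_divide fun_eq_iff less_imp_le)
  finally show ?thesis .
qed

lemma smooth_step_bounds: "0 \<le> smooth_step t" "smooth_step t \<le> 1"
  using flat0_nonneg[of t] flat0_nonneg[of "1 - t"] step_denominator_pos[of t]
  by (auto simp: smooth_step_def divide_le_eq)

lemma smooth_step_eq_0: "t \<le> 0 \<Longrightarrow> smooth_step t = 0"
  by (simp add: smooth_step_def flat0_eq_0_iff)

lemma smooth_step_eq_1: "t \<ge> 1 \<Longrightarrow> smooth_step t = 1"
  using flat0_eq_0_iff[of "1 - t"] step_denominator_pos[of t] by (simp add: smooth_step_def)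

definition plateau :: "real \<Rightarrow> real" where
  "plateau t = smooth_step (2 + 2 * t) * smooth_step (2 - 2 * t)"

lemma smooth_plateau: "smooth plateau"
  unfolding plateau_def
  using smooth_mult[OF smooth_compose[OF smooth_smooth_step smooth_affine_real[of 2 2]]
      smooth_compose[OF smooth_smooth_step smooth_affine_real[of 2 "-2"]]]
  by simp

lemma plateau_bounds: "0 \<le> plateau t" "plateau t \<le> 1"
  by (auto simp: plateau_def smooth_step_bounds mult_le_one)

lemma plateau_eq_1: "\<bar>t\<bar> \<le> 1/2 \<Longrightarrow> plateau t = 1"
  by (simp add: plateau_def smooth_step_eq_1)

lemma plateau_eq_0: "\<bar>t\<bar> \<ge> 1 \<Longrightarrow> plateau t = 0"
  by (cases "t \<ge> 0") (simp_all add: plateau_def smooth_step_eq_0)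

text \<open>
  Balls in the supremum norm: their volumes are explicit, their products are boxes in the product
  space, and translates of them tile the space.
\<close>

definition cube :: "'a::euclidean_space \<Rightarrow> real \<Rightarrow> 'a set" where
  "cube c r = cbox (c - r *\<^sub>R One) (c + r *\<^sub>R One)"

lemma mem_cube: "x \<in> cube c r \<longleftrightarrow> (\<forall>b\<in>Basis. \<bar>x \<bullet> b - c \<bullet> b\<bar> \<le> r)"
  by (auto simp: cube_def mem_box inner_diff_left inner_add_left abs_le_iff algebra_simps)

lemma compact_cube: "compact (cube c r)"
  by (simp add: cube_def)

lemma content_cube: 
  fixes c :: "'a::euclidean_space"
  assumes "r \<ge> 0" shows "measure lebesgue (cube c r) = (2 * r) ^ DIM('a)"
proof -
  have "measure lborel (cube c r) = (\<Prod>b\<in>(Basis :: 'a set). 2 * r)"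
    unfolding cube_def using assms
    by (subst content_cbox) (auto simp: inner_diff_left inner_add_left intro!: prod.cong)
  then show ?thesis by (simp add: cube_def measure_completion)
qed

definition bump :: "'a::euclidean_space \<Rightarrow> real" where
  "bump x = (\<Prod>b\<in>Basis. plateau (x \<bullet> b))"

lemma smooth_bump: "smooth bump"
  unfolding bump_def
  by (intro smooth_prod smooth_compose[OF smooth_plateau] smooth_bounded_linear bounded_linear_inner_left)

lemma bump_bounds: "0 \<le> bump x" "bump x \<le> 1"
  by (auto simp: bump_def plateau_bounds intro: prod_nonneg prod_le_1)

lemma bump_eq_1: "x \<in> cube 0 (1/2) \<Longrightarrow> bump x = 1"
  by (simp add: bump_def mem_cube plateau_eq_1)

lemma bump_eq_0: "x \<notin> cube 0 1 \<Longrightarrow> bump x = 0"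
  by (auto simp: bump_def mem_cube intro!: prod_zero bexI plateau_eq_0)

lemma smooth_bump_rescaled:
  fixes d :: "'a::euclidean_space"
  shows "smooth (\<lambda>x. bump ((x - d) /\<^sub>R r))"
  by (intro smooth_compose[OF smooth_bump] smooth_cmult smooth_diff smooth_const smooth_bounded_linear
      bounded_linear_ident)

section \<open>Schwartz functions, cut-offs and sequential continuity\<close>

lemma iter_partial_bounded:
  fixes f :: "'a::euclidean_space \<Rightarrow> 'b::real_normed_vector" and w :: "'a \<Rightarrow> real"
  assumes "smooth f" "compact K" "\<And>x. x \<notin> K \<Longrightarrow> f x = 0" "continuous_on UNIV w" "bs \<in> lists Basis"
  shows "\<exists>M. \<forall>x. \<bar>w x\<bar> * norm (iter_partial bs f x) \<le> M"
proof -
  have "continuous_on K (\<lambda>x. \<bar>w x\<bar> * norm (iter_partial bs f x))"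
    by (intro continuous_intros continuous_on_subset[OF assms(4)] smooth_continuous_on
        smooth_iter_partial assms) auto
  then have "bounded ((\<lambda>x. \<bar>w x\<bar> * norm (iter_partial bs f x)) ` K)"
    using assms(2) compact_continuous_image compact_imp_bounded by blast
  then obtain M where M: "\<And>x. x \<in> K \<Longrightarrow> \<bar>w x\<bar> * norm (iter_partial bs f x) \<le> M"
    unfolding bounded_real by (auto simp: abs_le_iff)
  have "\<bar>w x\<bar> * norm (iter_partial bs f x) \<le> max M 0" for x
  proof (cases "x \<in> K")
    case False
    then have "iter_partial bs f x = 0"
      using iter_partial_eq_0_on_open[of "- K" f x bs] assms compact_imp_closed by auto
    then show ?thesis by simp
  qed (use M in fastforce)
  then show ?thesis by blast
qed

lemma continuous_monomial: "continuous_on A (monomial as)"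
  unfolding monomial_def by (induction as) (auto intro!: continuous_intros)

lemma schwartzI_compact_support:
  assumes "smooth f" "compact K" "\<And>x. x \<notin> K \<Longrightarrow> f x = 0"
  shows "f \<in> schwartz"
  unfolding schwartz_def
proof (intro CollectI conjI ballI)
  fix as bs :: "'a list" assume "as \<in> lists Basis" "bs \<in> lists Basis"
  then obtain M where "\<And>x. \<bar>monomial as x\<bar> * norm (iter_partial bs f x) \<le> M"
    using iter_partial_bounded[OF assms continuous_monomial] by blast
  then show "bdd_above (range (\<lambda>x. \<bar>monomial as x\<bar> * norm (iter_partial bs f x)))"
    by (auto intro!: bdd_aboveI)
qed (rule assms)

lemma schwartz_smooth: "f \<in> schwartz \<Longrightarrow> smooth f"
  by (simp add: schwartz_def)

lemma schwartz_decay: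
  assumes "f \<in> schwartz" "as \<in> lists Basis" "bs \<in> lists Basis"
  obtains C where "\<And>x. \<bar>monomial as x\<bar> * norm (iter_partial bs f x) \<le> C"
proof -
  have "bdd_above (range (\<lambda>x. \<bar>monomial as x\<bar> * norm (iter_partial bs f x)))"
    using assms by (auto simp: schwartz_def)
  then show ?thesis using that by (auto simp: bdd_above_def)
qed

lemma schwartz_partial:
  assumes "f \<in> schwartz" "b \<in> Basis"
  shows "(\<lambda>x. frechet_derivative f (at x) b) \<in> schwartz"
  unfolding schwartz_def
proof (intro CollectI conjI ballI)
  show "smooth (\<lambda>x. frechet_derivative f (at x) b)"
    using assms schwartz_smooth smooth_partial by blast
  fix as bs :: "'a list" assume "as \<in> lists Basis" "bs \<in> lists Basis"
  then have "bdd_above (range (\<lambda>x. \<bar>monomial as x\<bar> * norm (iter_partial (bs @ [b]) f x)))"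
    using assms by (auto simp: schwartz_def)
  then show "bdd_above (range (\<lambda>x. \<bar>monomial as x\<bar> * norm (iter_partial bs (\<lambda>x. frechet_derivative f (at x) b) x)))"
    by (simp add: iter_partial_append)
qed

lemma iter_partial_cmult:
  assumes "smooth f" "bs \<in> lists Basis"
  shows "iter_partial bs (\<lambda>x. c *\<^sub>R f x) = (\<lambda>x. c *\<^sub>R iter_partial bs f x)"
  using assms(2)
proof (induction bs)
  case (Cons b bs)
  have "frechet_derivative (\<lambda>x. c *\<^sub>R iter_partial bs f x) (at x) = (\<lambda>v. c *\<^sub>R frechet_derivative (iter_partial bs f) (at x) v)" for x
    using frechet_derivative_at[OF has_derivative_scaleR_right[OF smooth_has_derivative[OF smooth_iter_partial]]]
      assms Cons by (metis listsE)
  then show ?case using Cons by (auto simp: Cons_in_lists_iff)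
qed auto

lemma iter_partial_diff:
  assumes "smooth f" "smooth g" "bs \<in> lists Basis"
  shows "iter_partial bs (\<lambda>x. f x - g x) = (\<lambda>x. iter_partial bs f x - iter_partial bs g x)"
  using iter_partial_add[OF assms(1) smooth_cmult[OF assms(2), of "-1"] assms(3)]
    iter_partial_cmult[OF assms(2,3), of "-1"] by simp

lemma iter_partial_dilation:
  fixes g :: "'a::euclidean_space \<Rightarrow> 'b::real_normed_vector"
  assumes "smooth g" "bs \<in> lists Basis"
  shows "iter_partial bs (\<lambda>x. g (c *\<^sub>R x)) = (\<lambda>x. c ^ length bs *\<^sub>R iter_partial bs g (c *\<^sub>R x))"
  using assms(2)
proof (induction bs)
  case (Cons b bs)
  then have b: "b \<in> Basis" "bs \<in> lists Basis" by auto
  let ?g = "iter_partial bs g"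
  have sm: "smooth ?g" using assms b smooth_iter_partial by blast
  have "((\<lambda>x. c ^ length bs *\<^sub>R ?g (c *\<^sub>R x)) has_derivative
      (\<lambda>v. c ^ length bs *\<^sub>R frechet_derivative ?g (at (c *\<^sub>R x)) (c *\<^sub>R v))) (at x)" for x
    by (intro has_derivative_scaleR_right has_derivative_compose[OF _ smooth_has_derivative[OF sm]])
       (auto intro!: derivative_eq_intros)
  then have "frechet_derivative (\<lambda>x. c ^ length bs *\<^sub>R ?g (c *\<^sub>R x)) (at x) =
      (\<lambda>v. c ^ length bs *\<^sub>R frechet_derivative ?g (at (c *\<^sub>R x)) (c *\<^sub>R v))" for x
    using frechet_derivative_at by metis
  moreover have "linear (frechet_derivative ?g (at y))" for y
    using smooth_has_derivative[OF sm] has_derivative_linear by blast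
  ultimately show ?case using Cons b by (simp add: linear_cmul mult.commute)
qed auto

text \<open>
  The multipliers \<open>\<chi>\<^sub>N - 1\<close> for cut-offs \<open>\<chi>\<^sub>N\<close> are of this kind. Bounds on all derivatives are
  included so that the notion is stable under partial derivatives.
\<close>

definition escaping :: "(nat \<Rightarrow> 'a::euclidean_space \<Rightarrow> real) \<Rightarrow> bool" where
  "escaping h \<longleftrightarrow> (\<forall>N. smooth (h N)) \<and>
     (\<forall>bs\<in>lists Basis. \<exists>M. \<forall>N x. \<bar>iter_partial bs (h N) x\<bar> \<le> M) \<and>
     (\<forall>N x. norm x < real (Suc N) / 2 \<longrightarrow> h N x = 0)"

lemma escaping_partial:
  assumes "escaping h" "b \<in> Basis"
  shows "escaping (\<lambda>N x. frechet_derivative (h N) (at x) b)"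
  unfolding escaping_def
proof (intro conjI allI ballI impI)
  show "smooth (\<lambda>x. frechet_derivative (h N) (at x) b)" for N
    using assms smooth_partial by (auto simp: escaping_def)
  show "\<exists>M. \<forall>N x. \<bar>iter_partial bs (\<lambda>x. frechet_derivative (h N) (at x) b) x\<bar> \<le> M"
    if "bs \<in> lists Basis" for bs
  proof -
    have "bs @ [b] \<in> lists Basis" using that assms by simp
    then have "\<exists>M. \<forall>N x. \<bar>iter_partial (bs @ [b]) (h N) x\<bar> \<le> M"
      using assms(1) unfolding escaping_def by blast
    then show ?thesis by (simp add: iter_partial_append)
  qed
  fix N and x :: 'a assume x: "norm x < real (Suc N) / 2"
  show "frechet_derivative (h N) (at x) b = 0"
    by (rule frechet_derivative_eq_0_on_open(1)[of "ball 0 (real (Suc N) / 2)"])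
       (use assms(1) x in \<open>auto simp: escaping_def\<close>)
qed

text \<open>
  Where \<open>h N\<close> does not vanish, \<open>1 \<le> 2 \<bar>x\<bar> / (N + 1)\<close>, and the factor \<open>\<bar>x\<bar>\<close> is absorbed by the rapid
  decay of \<open>\<phi>\<close>. By the product rule a derivative of the product is a sum of two products of the same
  kind; the induction takes the innermost derivative, the last of the list, first.
\<close>

lemma escaping_times_schwartz_decay:
  fixes h :: "nat \<Rightarrow> 'a::euclidean_space \<Rightarrow> real" and \<phi> :: "'a \<Rightarrow> complex"
  assumes "escaping h" "\<phi> \<in> schwartz" "as \<in> lists Basis" "bs \<in> lists Basis"
  shows "\<exists>C. \<forall>N x. \<bar>monomial as x\<bar> * norm (iter_partial bs (\<lambda>x. h N x *\<^sub>R \<phi> x) x) \<le> C / real (Suc N)"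
  using assms(4,1,2)
proof (induction bs arbitrary: h \<phi> rule: rev_induct)
  case Nil
  obtain M where M: "\<And>N x. \<bar>h N x\<bar> \<le> M"
    using Nil(2) unfolding escaping_def by (metis iter_partial.simps(1) lists.Nil)
  then have M0: "M \<ge> 0" by (metis abs_ge_zero order_trans)
  have "\<exists>C. \<forall>x. \<bar>monomial (b # as) x\<bar> * norm (\<phi> x) \<le> C" if "b \<in> Basis" for b
  proof -
    have "b # as \<in> lists Basis" using that assms(3) by simp
    from schwartz_decay[OF Nil(3) this lists.Nil] show ?thesis by (metis iter_partial.simps(1))
  qed
  then obtain C where C: "\<And>b x. b \<in> Basis \<Longrightarrow> \<bar>monomial (b # as) x\<bar> * norm (\<phi> x) \<le> C b" by metis
  have "\<bar>monomial as x\<bar> * norm (h N x *\<^sub>R \<phi> x) \<le> 2 * M * (\<Sum>b\<in>Basis. C b) / real (Suc N)" for N x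
  proof -
    have "\<bar>monomial as x\<bar> * norm (\<phi> x) * norm x \<le> \<bar>monomial as x\<bar> * norm (\<phi> x) * (\<Sum>b\<in>Basis. \<bar>x \<bullet> b\<bar>)"
      by (intro mult_left_mono norm_le_l1) auto
    also have "\<dots> = (\<Sum>b\<in>Basis. \<bar>monomial (b # as) x\<bar> * norm (\<phi> x))"
      by (simp add: sum_distrib_left monomial_def abs_mult mult_ac)
    also have "\<dots> \<le> (\<Sum>b\<in>Basis. C b)" by (intro sum_mono C)
    finally have *: "\<bar>monomial as x\<bar> * norm (\<phi> x) * norm x \<le> (\<Sum>b\<in>Basis. C b)" .
    moreover have "0 \<le> \<bar>monomial as x\<bar> * norm (\<phi> x) * norm x" by simp
    ultimately have S0: "0 \<le> (\<Sum>b\<in>Basis. C b)" by linarith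
    show ?thesis
    proof (cases "norm x < real (Suc N) / 2")
      case True
      then have "h N x = 0" using Nil(2) by (auto simp: escaping_def)
      then show ?thesis using M0 S0 by simp
    next
      case False
      then have "1 \<le> 2 * norm x / real (Suc N)" by (simp add: field_simps)
      then have "\<bar>monomial as x\<bar> * norm (h N x *\<^sub>R \<phi> x) * 1 \<le>
          \<bar>monomial as x\<bar> * norm (h N x *\<^sub>R \<phi> x) * (2 * norm x / real (Suc N))"
        by (rule mult_left_mono) simp
      also have "\<dots> = (2 / real (Suc N) * (\<bar>monomial as x\<bar> * norm (\<phi> x) * norm x)) * \<bar>h N x\<bar>"
        by simp
      also have "\<dots> \<le> (2 / real (Suc N) * (\<Sum>b\<in>Basis. C b)) * M"
        by (intro mult_mono * M mult_left_mono) (auto simp: S0)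
      finally show ?thesis by (simp add: mult_ac)
    qed
  qed
  then show ?case by auto
next
  case (snoc b bs)
  then have b: "b \<in> Basis" "bs \<in> lists Basis" by auto
  let ?h = "\<lambda>N x. frechet_derivative (h N) (at x) b"
  let ?\<phi> = "\<lambda>x. frechet_derivative \<phi> (at x) b"
  have hs: "smooth (h N)" for N using snoc(3) by (auto simp: escaping_def)
  have \<phi>s: "smooth \<phi>" using snoc schwartz_smooth by blast
  have hs': "smooth (?h N)" and \<phi>s': "smooth ?\<phi>" for N
    using hs \<phi>s smooth_partial b by blast+
  have prod_rule: "iter_partial (bs @ [b]) (\<lambda>x. h N x *\<^sub>R \<phi> x) =
     (\<lambda>x. iter_partial bs (\<lambda>x. h N x *\<^sub>R ?\<phi> x) x + iter_partial bs (\<lambda>x. ?h N x *\<^sub>R \<phi> x) x)" for N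
  proof -
    have D: "((\<lambda>x. h N x *\<^sub>R \<phi> x) has_derivative (\<lambda>v. h N x *\<^sub>R frechet_derivative \<phi> (at x) v +
        frechet_derivative (h N) (at x) v *\<^sub>R \<phi> x)) (at x)" for x
      by (intro has_derivative_scaleR smooth_has_derivative hs \<phi>s)
    have "frechet_derivative (\<lambda>x. h N x *\<^sub>R \<phi> x) (at x) b = h N x *\<^sub>R ?\<phi> x + ?h N x *\<^sub>R \<phi> x" for x
      by (subst frechet_derivative_at[OF D, symmetric]) (rule refl)
    then show ?thesis
      using iter_partial_add[OF smooth_scaleR[OF hs \<phi>s'] smooth_scaleR[OF hs' \<phi>s] b(2)]
      by (simp add: iter_partial_append)
  qed
  obtain C1 where C1: "\<And>N x. \<bar>monomial as x\<bar> * norm (iter_partial bs (\<lambda>x. h N x *\<^sub>R ?\<phi> x) x) \<le> C1 / real (Suc N)"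
    using snoc(1)[OF b(2) snoc(3) schwartz_partial[OF snoc(4) b(1)]] by blast
  obtain C2 where C2: "\<And>N x. \<bar>monomial as x\<bar> * norm (iter_partial bs (\<lambda>x. ?h N x *\<^sub>R \<phi> x) x) \<le> C2 / real (Suc N)"
    using snoc(1)[OF b(2) escaping_partial[OF snoc(3) b(1)] snoc(4)] by blast
  have "\<bar>monomial as x\<bar> * norm (iter_partial (bs @ [b]) (\<lambda>x. h N x *\<^sub>R \<phi> x) x) \<le> (C1 + C2) / real (Suc N)" for N x
  proof -
    have "\<bar>monomial as x\<bar> * norm (iter_partial (bs @ [b]) (\<lambda>x. h N x *\<^sub>R \<phi> x) x) \<le>
      \<bar>monomial as x\<bar> * (norm (iter_partial bs (\<lambda>x. h N x *\<^sub>R ?\<phi> x) x) + norm (iter_partial bs (\<lambda>x. ?h N x *\<^sub>R \<phi> x) x))"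
      unfolding prod_rule by (intro mult_left_mono norm_triangle_ineq) auto
    then show ?thesis using C1[of x N] C2[of x N] by (simp add: distrib_left add_divide_distrib)
  qed
  then show ?case by blast
qed

lemma iter_partial_const_bound:
  fixes c :: "'b::real_normed_vector" and x :: "'a::euclidean_space"
  shows "norm (iter_partial bs (\<lambda>x. c) x) \<le> norm c"
proof (cases bs rule: rev_cases)
  case (snoc cs b)
  have "iter_partial cs (\<lambda>x::'a. 0::'b) = (\<lambda>x. 0)" by (rule iter_partial_zero)
  then have "iter_partial cs (\<lambda>x. 0) x = (0 :: 'b)" for x :: 'a by metis
  then show ?thesis using snoc by (simp add: iter_partial_append)
qed simp

definition cutoff :: "nat \<Rightarrow> 'a::euclidean_space \<Rightarrow> real" where
  "cutoff N x = bump (x /\<^sub>R real (Suc N))"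

lemma cutoff_bounds: "0 \<le> cutoff N x" "cutoff N x \<le> 1"
  by (simp_all add: cutoff_def bump_bounds)

lemma cutoff_eq_1: "norm x < real (Suc N) / 2 \<Longrightarrow> cutoff N x = 1"
  unfolding cutoff_def
proof (rule bump_eq_1)
  assume x: "norm x < real (Suc N) / 2"
  have "\<bar>x \<bullet> b\<bar> / real (Suc N) \<le> 1 / 2" if "b \<in> Basis" for b
    using Basis_le_norm[OF that, of x] x by (simp add: field_simps)
  then show "x /\<^sub>R real (Suc N) \<in> cube 0 (1 / 2)"
    by (simp add: mem_cube abs_mult field_simps)
qed

lemma cutoff_eq_0: "x \<notin> cube 0 (real (Suc N)) \<Longrightarrow> cutoff N x = 0"
  unfolding cutoff_def by (rule bump_eq_0) (auto simp: mem_cube abs_mult field_simps)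

lemma smooth_cutoff: "smooth (cutoff N)"
proof -
  have "cutoff N = (\<lambda>x::'a. bump ((x - 0) /\<^sub>R real (Suc N)))" by (simp add: cutoff_def fun_eq_iff)
  then show ?thesis using smooth_bump_rescaled by metis
qed

lemma escaping_cutoff: "escaping (\<lambda>N x. cutoff N x - 1)"
  unfolding escaping_def
proof (intro conjI allI ballI impI)
  show "smooth (\<lambda>x. cutoff N x - 1)" for N by (intro smooth_diff smooth_cutoff smooth_const)
  show "cutoff N x - 1 = 0" if "norm x < real (Suc N) / 2" for N and x :: 'a
    using cutoff_eq_1[OF that] by simp
  fix bs :: "'a list" assume bs: "bs \<in> lists Basis"
  obtain M where M: "\<And>x::'a. norm (iter_partial bs bump x) \<le> M"
    using iter_partial_bounded[OF smooth_bump compact_cube[of 0 1] bump_eq_0, of "\<lambda>x. 1" bs] bs by auto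
  have "\<bar>iter_partial bs (\<lambda>x. cutoff N x - 1) x\<bar> \<le> M + 1" for N x
  proof -
    have "iter_partial bs (\<lambda>x. cutoff N x - 1) x =
      inverse (real (Suc N)) ^ length bs *\<^sub>R iter_partial bs bump (x /\<^sub>R real (Suc N)) - iter_partial bs (\<lambda>x. 1) x"
    proof -
      have "iter_partial bs (cutoff N) = iter_partial bs (\<lambda>x. bump (x /\<^sub>R real (Suc N)))"
        by (rule arg_cong[where f = "iter_partial bs"]) (simp add: cutoff_def fun_eq_iff)
      then show ?thesis
        using iter_partial_diff[OF smooth_cutoff smooth_const bs, of N 1]
          iter_partial_dilation[OF smooth_bump bs, of "inverse (real (Suc N))"] by simp
    qed
    also have "norm \<dots> \<le> 1 * M + 1"
    proof (rule order_trans[OF norm_triangle_ineq4 add_mono])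
      show "norm (inverse (real (Suc N)) ^ length bs *\<^sub>R iter_partial bs bump (x /\<^sub>R real (Suc N))) \<le> 1 * M"
        unfolding norm_scaleR
        by (intro mult_mono M) (auto simp: abs_mult power_abs inverse_le_1_iff intro!: power_le_one)
      show "norm (iter_partial bs (\<lambda>x. 1 :: real) x) \<le> 1"
        using iter_partial_const_bound[of bs "1::real" x] by simp
    qed
    finally show ?thesis by simp
  qed
  then show "\<exists>M. \<forall>N x. \<bar>iter_partial bs (\<lambda>x. cutoff N x - 1) x\<bar> \<le> M" by blast
qed

lemma schwartz_diff:
  assumes "f \<in> schwartz" "g \<in> schwartz" shows "(\<lambda>x. f x - g x) \<in> schwartz"
  unfolding schwartz_def
proof (intro CollectI conjI ballI)
  have sm: "smooth f" "smooth g" using assms schwartz_smooth by auto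
  then show "smooth (\<lambda>x. f x - g x)" by (rule smooth_diff)
  fix as bs :: "'a list" assume l: "as \<in> lists Basis" "bs \<in> lists Basis"
  obtain C1 where C1: "\<And>x. \<bar>monomial as x\<bar> * norm (iter_partial bs f x) \<le> C1"
    using schwartz_decay[OF assms(1) l] by blast
  obtain C2 where C2: "\<And>x. \<bar>monomial as x\<bar> * norm (iter_partial bs g x) \<le> C2"
    using schwartz_decay[OF assms(2) l] by blast
  have "\<bar>monomial as x\<bar> * norm (iter_partial bs (\<lambda>x. f x - g x) x) \<le> C1 + C2" for x
  proof -
    have "\<bar>monomial as x\<bar> * norm (iter_partial bs (\<lambda>x. f x - g x) x) \<le>
        \<bar>monomial as x\<bar> * (norm (iter_partial bs f x) + norm (iter_partial bs g x))"
      unfolding iter_partial_diff[OF sm l(2)] by (intro mult_left_mono norm_triangle_ineq4) auto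
    then show ?thesis using C1[of x] C2[of x] by (simp add: distrib_left)
  qed
  then show "bdd_above (range (\<lambda>x. \<bar>monomial as x\<bar> * norm (iter_partial bs (\<lambda>x. f x - g x) x)))"
    by (auto intro!: bdd_aboveI)
qed

lemma schwartz_seminorm_bound:
  assumes "f \<in> schwartz" "as \<in> lists Basis" "bs \<in> lists Basis"
  shows "\<bar>monomial as x\<bar> * norm (iter_partial bs f x) \<le> schwartz_seminorm as bs f"
  unfolding schwartz_seminorm_def
  by (rule cSUP_upper) (use assms in \<open>auto simp: schwartz_def\<close>)

text \<open>
  The subbasic neighbourhoods are balls around arbitrary Schwartz functions \<open>f\<close>, not only around
  \<open>\<phi>\<close>; the triangle inequality for the seminorms shows that they absorb the sequence nevertheless.
\<close>

lemma tempered_distribution_tendsto: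
  fixes u :: "('a::euclidean_space \<Rightarrow> complex) \<Rightarrow> complex"
  assumes u: "tempered_distribution u"
    and \<phi>: "\<phi> \<in> schwartz" and \<psi>: "\<And>N. \<psi> N \<in> schwartz"
    and conv: "\<And>as bs. as \<in> lists Basis \<Longrightarrow> bs \<in> lists Basis \<Longrightarrow>
      \<exists>C. \<forall>N x. \<bar>monomial as x\<bar> * norm (iter_partial bs (\<lambda>x. \<psi> N x - \<phi> x) x) \<le> C / real (Suc N)"
  shows "(\<lambda>N. u (\<psi> N)) \<longlonglongrightarrow> u \<phi>"
proof (rule topological_tendstoI)
  define B :: "('a \<Rightarrow> complex) set set" where "B = {{g \<in> schwartz. schwartz_seminorm as bs (\<lambda>x. g x - f x) < e} | f as bs e.
        f \<in> schwartz \<and> as \<in> lists Basis \<and> bs \<in> lists Basis \<and> e > 0}"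
  have ev: "eventually (\<lambda>N. \<psi> N \<in> W) sequentially" if "generate_topology_on B W" "\<phi> \<in> W" for W
    using that
  proof induction
    case (Int S T)
    then show ?case by (auto intro: eventually_conj)
  next
    case (UN K)
    then obtain k where k: "k \<in> K" "\<phi> \<in> k" by blast
    then have "eventually (\<lambda>N. \<psi> N \<in> k) sequentially" using UN.IH by blast
    then show ?case by eventually_elim (use k in blast)
  next
    case (Basis W)
    then obtain f as bs e where f: "f \<in> schwartz" and l: "as \<in> lists Basis" "bs \<in> lists Basis" and "e > 0"
      and W: "W = {g \<in> schwartz. schwartz_seminorm as bs (\<lambda>x. g x - f x) < e}"
      unfolding B_def by blast
    let ?p = "\<lambda>g. schwartz_seminorm as bs g"
    have lt: "?p (\<lambda>x. \<phi> x - f x) < e" using Basis W by simp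
    obtain C where C: "\<And>N x. \<bar>monomial as x\<bar> * norm (iter_partial bs (\<lambda>x. \<psi> N x - \<phi> x) x) \<le> C / real (Suc N)"
      using conv[OF l] by blast
    have le: "?p (\<lambda>x. \<psi> N x - f x) \<le> C / real (Suc N) + ?p (\<lambda>x. \<phi> x - f x)" for N
      unfolding schwartz_seminorm_def[of as bs "\<lambda>x. \<psi> N x - f x"]
    proof (rule cSUP_least)
      fix x
      have sm: "smooth (\<lambda>x. \<psi> N x - \<phi> x)" "smooth (\<lambda>x. \<phi> x - f x)"
        by (intro smooth_diff schwartz_smooth \<psi> \<phi> f)+
      have "iter_partial bs (\<lambda>x. \<psi> N x - f x) x =
          iter_partial bs (\<lambda>x. \<psi> N x - \<phi> x) x + iter_partial bs (\<lambda>x. \<phi> x - f x) x"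
        using iter_partial_add[OF sm l(2)] by (simp add: fun_eq_iff)
      then have "\<bar>monomial as x\<bar> * norm (iter_partial bs (\<lambda>x. \<psi> N x - f x) x) \<le>
          \<bar>monomial as x\<bar> * (norm (iter_partial bs (\<lambda>x. \<psi> N x - \<phi> x) x) + norm (iter_partial bs (\<lambda>x. \<phi> x - f x) x))"
        by (auto intro!: mult_left_mono norm_triangle_ineq)
      then show "\<bar>monomial as x\<bar> * norm (iter_partial bs (\<lambda>x. \<psi> N x - f x) x) \<le> C / real (Suc N) + ?p (\<lambda>x. \<phi> x - f x)"
        using C[of x N] schwartz_seminorm_bound[OF schwartz_diff[OF \<phi> f] l, of x] by (simp add: distrib_left)
    qed simp
    have "(\<lambda>N. C / real (Suc N)) \<longlonglongrightarrow> 0"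
      by (rule LIMSEQ_Suc[OF lim_const_over_n])
    then have "(\<lambda>N. C / real (Suc N) + ?p (\<lambda>x. \<phi> x - f x)) \<longlonglongrightarrow> 0 + ?p (\<lambda>x. \<phi> x - f x)"
      by (intro tendsto_add tendsto_const)
    then have "eventually (\<lambda>N. C / real (Suc N) + ?p (\<lambda>x. \<phi> x - f x) < e) sequentially"
      using lt by (intro order_tendstoD(2)[of _ "0 + ?p (\<lambda>x. \<phi> x - f x)"]) auto
    then show ?case
      by eventually_elim (use le \<psi> W order_le_less_trans in blast)
  qed auto
  fix V assume "open V" "u \<phi> \<in> V"
  have "openin schwartz_topology {g \<in> topspace schwartz_topology. u g \<in> V}"
    using u \<open>open V\<close> unfolding tempered_distribution_def continuous_map_def by auto
  then have "generate_topology_on B {g \<in> topspace schwartz_topology. u g \<in> V}"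
    unfolding schwartz_topology_def B_def by (simp add: openin_topology_generated_by_iff)
  from ev[OF this] show "eventually (\<lambda>N. u (\<psi> N) \<in> V) sequentially"
    using \<phi> \<open>u \<phi> \<in> V\<close> by (auto simp: topspace_schwartz_topology elim: eventually_mono)
qed

lemma schwartz_cutoff:
  assumes "\<phi> \<in> schwartz"
  shows "(\<lambda>x. cutoff N x *\<^sub>R \<phi> x) \<in> schwartz"
  by (rule schwartzI_compact_support[OF smooth_scaleR[OF smooth_cutoff schwartz_smooth[OF assms]] compact_cube[of 0 "real (Suc N)"]])
     (simp add: cutoff_eq_0)

lemma tempered_distribution_cutoff_tendsto:
  assumes "tempered_distribution u" "\<phi> \<in> schwartz"
  shows "(\<lambda>N. u (\<lambda>x. cutoff N x *\<^sub>R \<phi> x)) \<longlonglongrightarrow> u \<phi>"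
proof (rule tempered_distribution_tendsto[OF assms schwartz_cutoff[OF assms(2)]])
  fix as bs :: "'a list" assume l: "as \<in> lists Basis" "bs \<in> lists Basis"
  have "(\<lambda>x. (cutoff N x - 1) *\<^sub>R \<phi> x) = (\<lambda>x. cutoff N x *\<^sub>R \<phi> x - \<phi> x)" for N
    by (simp add: scaleR_diff_left)
  then show "\<exists>C. \<forall>N x. \<bar>monomial as x\<bar> * norm (iter_partial bs (\<lambda>x. cutoff N x *\<^sub>R \<phi> x - \<phi> x) x) \<le> C / real (Suc N)"
    using escaping_times_schwartz_decay[OF escaping_cutoff assms(2) l] by simp
qed

section \<open>Integrals against Schwartz functions\<close>

lemma integrable_lebesgue_if_lborel:
  fixes f :: "'a::euclidean_space \<Rightarrow> 'b::{banach, second_countable_topology}"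
  shows "integrable lborel f \<Longrightarrow> integrable lebesgue f"
  by (subst integrable_completion) (auto dest: borel_measurable_integrable)

lemma nn_integral_inverse_1_plus_square_finite:
  "(\<integral>\<^sup>+x. ennreal (1 / (1 + x\<^sup>2)) \<partial>lborel) < \<infinity>"
proof -
  let ?f = "\<lambda>x::real. 1 / (1 + x\<^sup>2)"
  have half: "(\<integral>\<^sup>+x. ennreal (?f x) * indicator {0..} x \<partial>lborel) = ennreal (pi / 2 - arctan 0)"
    by (rule nn_integral_FTC_atLeast[OF _ _ _ tendsto_arctan_at_top])
       (auto intro!: derivative_eq_intros simp: inverse_eq_divide)
  have "(\<integral>\<^sup>+x. ennreal (?f x) * indicator {..0} x \<partial>lborel) =
      ennreal \<bar>- 1\<bar> * (\<integral>\<^sup>+x. ennreal (?f (0 + (- 1) * x)) * indicator {..0} (0 + (- 1) * x) \<partial>lborel)"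
    by (rule nn_integral_real_affine) auto
  also have "\<dots> = (\<integral>\<^sup>+x. ennreal (?f x) * indicator {0..} x \<partial>lborel)"
    by (auto intro!: nn_integral_cong simp: indicator_def)
  finally have half': "(\<integral>\<^sup>+x. ennreal (?f x) * indicator {..0} x \<partial>lborel) = ennreal (pi / 2 - arctan 0)"
    using half by simp
  have "(\<integral>\<^sup>+x. ennreal (?f x) \<partial>lborel) \<le>
      (\<integral>\<^sup>+x. ennreal (?f x) * indicator {0..} x + ennreal (?f x) * indicator {..0} x \<partial>lborel)"
    by (intro nn_integral_mono) (auto simp: indicator_def)
  also have "\<dots> = ennreal (pi / 2 - arctan 0) + ennreal (pi / 2 - arctan 0)"
    by (subst nn_integral_add) (auto simp: half half')
  also have "\<dots> < \<infinity>" by simp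
  finally show ?thesis .
qed

text \<open>
  A product of functions of one coordinate each, so that its integral is a product of
  one-dimensional integrals. It serves as the integrable majorant for Schwartz functions.
\<close>

lemma integrable_product_weight:
  "integrable lborel (\<lambda>x::'a::euclidean_space. \<Prod>b\<in>Basis. 1 / (1 + (x \<bullet> b)\<^sup>2))"
proof (rule integrableI_nonneg)
  have "nn_integral lborel (\<lambda>x::'a. ennreal (\<Prod>b\<in>Basis. 1 / (1 + (x \<bullet> b)\<^sup>2))) =
      nn_integral lborel (\<lambda>x::'a. \<Prod>b\<in>Basis. ennreal (1 / (1 + (x \<bullet> b)\<^sup>2)))"
    by (simp add: prod_ennreal)
  also have "\<dots> = (\<Prod>b\<in>(Basis :: 'a set). (\<integral>\<^sup>+x. ennreal (1 / (1 + x\<^sup>2)) \<partial>lborel))"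
    by (rule nn_integral_lborel_prod) auto
  also have "\<dots> < \<infinity>"
    using nn_integral_inverse_1_plus_square_finite by (simp add: power_less_top_ennreal)
  finally show "nn_integral lborel (\<lambda>x::'a. ennreal (\<Prod>b\<in>Basis. 1 / (1 + (x \<bullet> b)\<^sup>2))) < \<infinity>" .
qed (auto intro!: prod_nonneg)

text \<open>
  The weight is a sum of moduli of monomials, up to \<open>\<bar>x\<bar> \<le> \<Sum>\<bar>x\<^sub>b\<bar>\<close>. It is expanded one coordinate at
  a time, which is why the induction carries an arbitrary monomial along.
\<close>

lemma schwartz_weighted_decay:
  fixes \<phi> :: "'a::euclidean_space \<Rightarrow> complex"
  assumes "\<phi> \<in> schwartz"
  shows "\<exists>C. \<forall>x. (1 + norm x) * (\<Prod>b\<in>Basis. 1 + (x \<bullet> b)\<^sup>2) * norm (\<phi> x) \<le> C"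
proof -
  have weight: "\<exists>C. \<forall>x. (\<Prod>b\<in>A. 1 + (x \<bullet> b)\<^sup>2) * (\<bar>monomial as x\<bar> * norm (\<phi> x)) \<le> C"
    if "finite A" "A \<subseteq> Basis" "as \<in> lists Basis" for A as
    using that
  proof (induction A arbitrary: as)
    case empty
    from schwartz_decay[OF assms empty(2) lists.Nil] show ?case by simp metis
  next
    case (insert b A)
    then have b: "b \<in> Basis" "A \<subseteq> Basis" "b # b # as \<in> lists Basis" by auto
    obtain C1 where C1: "\<And>x. (\<Prod>b\<in>A. 1 + (x \<bullet> b)\<^sup>2) * (\<bar>monomial as x\<bar> * norm (\<phi> x)) \<le> C1"
      using insert.IH[OF b(2) insert.prems(2)] by blast
    obtain C2 where C2: "\<And>x. (\<Prod>b\<in>A. 1 + (x \<bullet> b)\<^sup>2) * (\<bar>monomial (b # b # as) x\<bar> * norm (\<phi> x)) \<le> C2"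
      using insert.IH[OF b(2,3)] by blast
    have "(\<Prod>b\<in>insert b A. 1 + (x \<bullet> b)\<^sup>2) * (\<bar>monomial as x\<bar> * norm (\<phi> x)) \<le> C1 + C2" for x
    proof -
      have "(\<Prod>b\<in>insert b A. 1 + (x \<bullet> b)\<^sup>2) * (\<bar>monomial as x\<bar> * norm (\<phi> x)) =
         (\<Prod>b\<in>A. 1 + (x \<bullet> b)\<^sup>2) * (\<bar>monomial as x\<bar> * norm (\<phi> x)) +
         (\<Prod>b\<in>A. 1 + (x \<bullet> b)\<^sup>2) * (\<bar>monomial (b # b # as) x\<bar> * norm (\<phi> x))"
        using insert.hyps by (simp add: monomial_def abs_mult algebra_simps power2_eq_square)
      then show ?thesis using C1[of x] C2[of x] by simp
    qed
    then show ?case by blast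
  qed
  obtain C0 where C0: "\<And>x. (\<Prod>b\<in>Basis. 1 + (x \<bullet> b)\<^sup>2) * (\<bar>monomial [] x\<bar> * norm (\<phi> x)) \<le> C0"
    using weight[OF finite_Basis order_refl lists.Nil] by blast
  have "\<exists>C. \<forall>x. (\<Prod>b\<in>Basis. 1 + (x \<bullet> b)\<^sup>2) * (\<bar>monomial [c] x\<bar> * norm (\<phi> x)) \<le> C" if "c \<in> Basis" for c
    by (rule weight) (use that in auto)
  then obtain C where C: "\<And>c x. c \<in> Basis \<Longrightarrow>
      (\<Prod>b\<in>Basis. 1 + (x \<bullet> b)\<^sup>2) * (\<bar>monomial [c] x\<bar> * norm (\<phi> x)) \<le> C c" by metis
  have "(1 + norm x) * (\<Prod>b\<in>Basis. 1 + (x \<bullet> b)\<^sup>2) * norm (\<phi> x) \<le> C0 + (\<Sum>c\<in>Basis. C c)" for x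
  proof -
    let ?P = "\<Prod>b\<in>Basis. 1 + (x \<bullet> b)\<^sup>2"
    have P: "?P \<ge> 0" by (intro prod_nonneg) auto
    have "(1 + norm x) * ?P * norm (\<phi> x) = ?P * (\<bar>monomial [] x\<bar> * norm (\<phi> x)) + ?P * norm (\<phi> x) * norm x"
      by (simp add: monomial_def algebra_simps)
    also have "?P * norm (\<phi> x) * norm x \<le> ?P * norm (\<phi> x) * (\<Sum>c\<in>Basis. \<bar>x \<bullet> c\<bar>)"
      by (intro mult_left_mono norm_le_l1) (simp add: P)
    also have "\<dots> = (\<Sum>c\<in>Basis. ?P * (\<bar>monomial [c] x\<bar> * norm (\<phi> x)))"
      unfolding sum_distrib_left by (rule sum.cong) (simp_all add: monomial_def)
    also have "?P * (\<bar>monomial [] x\<bar> * norm (\<phi> x)) + \<dots> \<le> C0 + (\<Sum>c\<in>Basis. C c)"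
      by (intro add_mono sum_mono C C0)
    finally show ?thesis by simp
  qed
  then show ?thesis by blast
qed

lemma integrable_times_schwartz:
  fixes f \<phi> :: "'a::euclidean_space \<Rightarrow> complex"
  assumes f: "continuous_on UNIV f" and B: "\<And>x. norm (f x) \<le> B * (1 + norm x)" and \<phi>: "\<phi> \<in> schwartz"
  shows "integrable lebesgue (\<lambda>x. f x * \<phi> x)"
proof -
  obtain C where C: "\<And>x. (1 + norm x) * (\<Prod>b\<in>Basis. 1 + (x \<bullet> b)\<^sup>2) * norm (\<phi> x) \<le> C"
    using schwartz_weighted_decay[OF \<phi>] by blast
  show ?thesis
  proof (rule integrable_lebesgue_if_lborel, rule Bochner_Integration.integrable_bound)
    show "integrable lborel (\<lambda>x::'a. (B * C) * (\<Prod>b\<in>Basis. 1 / (1 + (x \<bullet> b)\<^sup>2)))"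
      by (intro integrable_mult_right integrable_product_weight)
    have [measurable]: "f \<in> borel_measurable borel" "\<phi> \<in> borel_measurable borel"
      using f smooth_continuous_on[OF schwartz_smooth[OF \<phi>], of UNIV] borel_measurable_continuous_onI by blast+
    show "(\<lambda>x. f x * \<phi> x) \<in> borel_measurable lborel" by measurable
    have B0: "B \<ge> 0" using order_trans[OF norm_ge_zero B[of 0]] by simp
    have "norm (f x * \<phi> x) \<le> norm ((B * C) * (\<Prod>b\<in>Basis. 1 / (1 + (x \<bullet> b)\<^sup>2)))" for x
    proof -
      let ?P = "\<Prod>b\<in>Basis. 1 + (x \<bullet> b)\<^sup>2"
      have P: "?P > 0" by (intro prod_pos) (auto simp: add_pos_nonneg)
      have "norm (f x * \<phi> x) \<le> B * (1 + norm x) * norm (\<phi> x)"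
        unfolding norm_mult by (intro mult_right_mono B) auto
      also have "\<dots> = B * ((1 + norm x) * ?P * norm (\<phi> x)) / ?P"
      proof -
        have "B * (1 + norm x) * norm (\<phi> x) = B * ((1 + norm x) * q * norm (\<phi> x)) / q" if "q > 0" for q :: real
          using that by (simp add: field_simps)
        from this[OF P] show ?thesis .
      qed
      also have "\<dots> \<le> B * C / ?P"
        using P B0 by (intro divide_right_mono mult_left_mono C) auto
      also have "\<dots> = (B * C) * (\<Prod>b\<in>Basis. 1 / (1 + (x \<bullet> b)\<^sup>2))"
        by (simp add: prod_dividef)
      finally show ?thesis by simp
    qed
    then show "AE x in lborel. norm (f x * \<phi> x) \<le> norm ((B * C) * (\<Prod>b\<in>Basis. 1 / (1 + (x \<bullet> b)\<^sup>2)))" by simp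
  qed
qed

lemma integrable_schwartz:
  fixes \<phi> :: "'a::euclidean_space \<Rightarrow> complex"
  assumes "\<phi> \<in> schwartz" shows "integrable lebesgue \<phi>"
  using integrable_times_schwartz[of "\<lambda>x. 1" 1 \<phi>] assms by simp

lemma integral_cutoff_tendsto:
  fixes f \<phi> :: "'a::euclidean_space \<Rightarrow> complex"
  assumes "integrable lebesgue (\<lambda>x. f x * \<phi> x)"
  shows "(\<lambda>N. integral\<^sup>L lebesgue (\<lambda>x. f x * (cutoff N x *\<^sub>R \<phi> x))) \<longlonglongrightarrow> integral\<^sup>L lebesgue (\<lambda>x. f x * \<phi> x)"
proof (rule integral_dominated_convergence)
  show "(\<lambda>x. f x * \<phi> x) \<in> borel_measurable lebesgue" using assms by auto
  have "cutoff N \<in> borel_measurable lborel" for N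
    using smooth_continuous_on[OF smooth_cutoff, of UNIV] borel_measurable_continuous_onI by fastforce
  then have "cutoff N \<in> borel_measurable lebesgue" for N by (rule measurable_completion)
  then have "(\<lambda>x. cutoff N x *\<^sub>R (f x * \<phi> x)) \<in> borel_measurable lebesgue" for N
    using assms by (intro borel_measurable_scaleR) auto
  then show "(\<lambda>x. f x * (cutoff N x *\<^sub>R \<phi> x)) \<in> borel_measurable lebesgue" for N by simp
  show "integrable lebesgue (\<lambda>x. norm (f x * \<phi> x))" using assms by auto
  show "AE x in lebesgue. norm (f x * (cutoff N x *\<^sub>R \<phi> x)) \<le> norm (f x * \<phi> x)" for N
  proof (rule AE_I2)
    fix x :: 'a
    have "\<bar>cutoff N x\<bar> \<le> 1" using cutoff_bounds[of N x] by simp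
    then show "norm (f x * (cutoff N x *\<^sub>R \<phi> x)) \<le> norm (f x * \<phi> x)"
      by (auto simp: norm_mult intro!: mult_left_mono mult_left_le_one_le)
  qed
  show "AE x in lebesgue. (\<lambda>N. f x * (cutoff N x *\<^sub>R \<phi> x)) \<longlonglongrightarrow> f x * \<phi> x"
  proof (rule AE_I2)
    fix x :: 'a
    have "eventually (\<lambda>N. norm x < real (Suc N) / 2) sequentially"
    proof -
      obtain N0 :: nat where "2 * norm x < real N0" using reals_Archimedean2 by blast
      then show ?thesis unfolding eventually_sequentially by (intro exI[of _ N0]) auto
    qed
    then have "eventually (\<lambda>N. f x * (cutoff N x *\<^sub>R \<phi> x) = f x * \<phi> x) sequentially"
      by eventually_elim (simp add: cutoff_eq_1)
    then show "(\<lambda>N. f x * (cutoff N x *\<^sub>R \<phi> x)) \<longlonglongrightarrow> f x * \<phi> x"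
      by (rule tendsto_eventually)
  qed
qed

section \<open>Off-diagonal test functions built from two bumps\<close>

text \<open>
  The weight \<open>\<bar>x - y\<bar>\<^sup>s\<^sup>+\<^sup>n\<close> is the reciprocal of the kernel of the fractional divergence, and the factor
  \<open>1 / 2\<close> compensates the factor \<open>2\<close> there.
\<close>

definition od_test :: "real \<Rightarrow> ('a::euclidean_space \<Rightarrow> complex) \<Rightarrow> ('a \<Rightarrow> real) \<Rightarrow> 'a \<times> 'a \<Rightarrow> complex" where
  "od_test s a b z = (norm (fst z - snd z) powr (s + real DIM('a)) / 2) *\<^sub>R
     (b (snd z) *\<^sub>R a (fst z) - b (fst z) *\<^sub>R a (snd z))"

lemma norm_powr_eq_inner_powr: "norm v powr t = (v \<bullet> v) powr (t / 2)"
proof (cases "v = 0")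
  case False
  then have "v \<bullet> v = norm v powr 2"
    by (simp add: power2_norm_eq_inner)
  then show ?thesis by (simp only: powr_powr) simp
qed simp

text \<open>
  The distance to the diagonal is not smooth, but its square is a polynomial; hence the detour
  through powers of \<open>\<bar>x - y\<bar>\<^sup>2\<close>.
\<close>

lemma smooth_distance_power:
  fixes g :: "'a::euclidean_space \<times> 'a \<Rightarrow> complex"
  assumes "smooth g" "closed K" "\<And>z. z \<in> K \<Longrightarrow> fst z \<noteq> snd z" "\<And>z. z \<notin> K \<Longrightarrow> g z = 0"
  shows "smooth (\<lambda>z. (norm (fst z - snd z) powr t) *\<^sub>R g z)"
proof -
  have lin: "bounded_linear (\<lambda>z::'a \<times> 'a. (fst z - snd z) \<bullet> b)" for b
    by (intro bounded_linear_compose[OF bounded_linear_inner_left] bounded_linear_sub bounded_linear_fst bounded_linear_snd)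
  have "smooth (\<lambda>z::'a \<times> 'a. \<Sum>b\<in>Basis. ((fst z - snd z) \<bullet> b) * ((fst z - snd z) \<bullet> b))"
    by (intro smooth_sum smooth_mult smooth_bounded_linear lin)
  then have "smooth (\<lambda>z::'a \<times> 'a. (fst z - snd z) \<bullet> (fst z - snd z))"
    by (subst euclidean_inner)
  then have "smooth (\<lambda>z. (((fst z - snd z) \<bullet> (fst z - snd z)) powr (t / 2)) *\<^sub>R g z)"
    by (rule smooth_powr_scaleR[OF _ assms(1,2) _ assms(4)]) (use assms(3) in auto)
  then show ?thesis by (simp add: norm_powr_eq_inner_powr)
qed

text \<open>
  As \<open>A\<close> and \<open>B\<close> are disjoint, \<open>A \<times> B \<union> B \<times> A\<close> is a compact set off the diagonal, so the function
  vanishes in a neighbourhood of the diagonal.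
\<close>

lemma od_test_schwartz_od:
  fixes a :: "'a::euclidean_space \<Rightarrow> complex" and b :: "'a \<Rightarrow> real"
  assumes a: "smooth a" "\<And>x. x \<notin> A \<Longrightarrow> a x = 0" and b: "smooth b" "\<And>x. x \<notin> B \<Longrightarrow> b x = 0"
    and AB: "compact A" "compact B" "A \<inter> B = {}"
  shows "od_test s a b \<in> schwartz_od"
proof -
  let ?K = "A \<times> B \<union> B \<times> A"
  have cK: "compact ?K" using AB by (intro compact_Un compact_Times)
  have sm1: "smooth (\<lambda>z::'a \<times> 'a. b (snd z) *\<^sub>R a (fst z) - b (fst z) *\<^sub>R a (snd z))"
    by (intro smooth_diff smooth_scaleR smooth_compose[OF a(1)] smooth_compose[OF b(1)]
        smooth_bounded_linear bounded_linear_fst bounded_linear_snd)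
  have off: "b (snd z) *\<^sub>R a (fst z) - b (fst z) *\<^sub>R a (snd z) = 0" if "z \<notin> ?K" for z
    using that a(2) b(2) by (cases z) auto
  have "smooth (\<lambda>z. norm (fst z - snd z) powr (s + real DIM('a)) *\<^sub>R
      (b (snd z) *\<^sub>R a (fst z) - b (fst z) *\<^sub>R a (snd z)))"
    by (rule smooth_distance_power[OF sm1 compact_imp_closed[OF cK] _ off]) (use AB in auto)
  from smooth_cmult[OF this, of "1/2"] have sm: "smooth (od_test s a b)"
    by (simp add: od_test_def[abs_def] scaleR_diff_right)
  have zero: "od_test s a b z = 0" if "z \<notin> ?K" for z
    using off[OF that] by (simp add: od_test_def)
  show ?thesis unfolding schwartz_od_def
  proof (intro CollectI conjI ballI allI)
    show "od_test s a b \<in> schwartz" by (rule schwartzI_compact_support[OF sm cK zero])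
    show "od_test s a b (x, y) = - od_test s a b (y, x)" for x y
      by (simp add: od_test_def norm_minus_commute scaleR_diff_right)
    have "open (- ?K)" using compact_imp_closed[OF cK] by (rule open_Compl)
    then show "iter_partial bs (od_test s a b) (z, z) = 0" for bs z
      by (rule iter_partial_eq_0_on_open) (use zero AB(3) in auto)
  qed
qed

text \<open>
  Off the diagonal the weight cancels the kernel. On the diagonal the left-hand integrand is zero,
  and so is the right-hand one, because \<open>a\<close> and \<open>b\<close> do not overlap.
\<close>

lemma frac_div_od_test:
  fixes a :: "'a::euclidean_space \<Rightarrow> complex" and b :: "'a \<Rightarrow> real"
  assumes "integrable lebesgue a" "integrable lebesgue b" and disj: "\<And>x. a x = 0 \<or> b x = 0"
  shows "frac_div s (od_test s a b) =
    (\<lambda>x. of_real (integral\<^sup>L lebesgue b) * a x - integral\<^sup>L lebesgue a * of_real (b x))"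
proof
  fix x
  have "2 * od_test s a b (x, y) / of_real (norm (x - y) powr s) / of_real (norm (x - y) ^ DIM('a)) =
      of_real (b y) * a x - a y * of_real (b x)" for y
  proof (cases "x = y")
    case True
    then show ?thesis using disj[of x] by (auto simp: od_test_def)
  next
    case False
    then have "norm (x - y) powr (s + real DIM('a)) = norm (x - y) powr s * norm (x - y) ^ DIM('a)"
      by (simp add: powr_add powr_realpow)
    then show ?thesis using False by (simp add: od_test_def scaleR_conv_of_real field_simps)
  qed
  then have "frac_div s (od_test s a b) x = integral\<^sup>L lebesgue (\<lambda>y. of_real (b y) * a x - a y * of_real (b x))"
    by (simp add: frac_div_def)
  also have "\<dots> = of_real (integral\<^sup>L lebesgue b) * a x - integral\<^sup>L lebesgue a * of_real (b x)"
    using assms by (subst Bochner_Integration.integral_diff) auto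
  finally show "frac_div s (od_test s a b) x =
    of_real (integral\<^sup>L lebesgue b) * a x - integral\<^sup>L lebesgue a * of_real (b x)" .
qed

section \<open>Bounds for the off-diagonal pairing\<close>

text \<open>
  This elementary inequality replaces Hoelder's: integrated over a set \<open>E\<close> with the choice
  \<open>l = \<parallel>F\<parallel> \<bar>E\<bar>\<^sup>-\<^sup>1\<^sup>/\<^sup>p\<close>, it gives \<open>\<integral>\<^sub>E \<bar>F\<bar> \<le> 2 \<bar>E\<bar>\<^sup>1\<^sup>-\<^sup>1\<^sup>/\<^sup>p \<parallel>F\<parallel>\<close>.
\<close>

lemma Young_cutoff:
  fixes t l p :: real
  assumes "t \<ge> 0" "l > 0" "p \<ge> 1"
  shows "t \<le> l + l powr (1 - p) * t powr p"
proof (cases "t \<le> l")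
  case False
  then have "t > 0" using assms by linarith
  have "1 \<le> (t / l) powr (p - 1)" using False assms by (intro ge_one_powr_ge_zero) auto
  then have "t * 1 \<le> t * (t / l) powr (p - 1)" using assms by (intro mult_left_mono) auto
  also have "\<dots> = l powr (1 - p) * t powr p"
    using \<open>t > 0\<close> assms by (simp add: powr_divide powr_diff powr_minus field_simps)
  finally show ?thesis using assms by simp
qed (simp add: add_increasing2)

text \<open>
  The parameter \<open>l\<close> remains free here and is chosen once the size of \<open>E\<close> is known.
\<close>

lemma od_pairing_bound:
  fixes F G :: "'a::euclidean_space \<times> 'a \<Rightarrow> complex"
  assumes F: "F \<in> Lp_od p" and p: "p \<ge> 1" and r: "r > 0" and l: "l > 0" and M: "M \<ge> 0"
    and E: "E \<in> lmeasurable" "measure lebesgue E \<le> V"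
    and apart: "\<And>z. z \<in> E \<Longrightarrow> 2 * r \<le> norm (fst z - snd z)"
    and G: "\<And>z. z \<in> E \<Longrightarrow> norm (G z) \<le> M" "\<And>z. z \<notin> E \<Longrightarrow> G z = 0"
  shows "norm (od_pairing F G) \<le> M * (l * V / (2 * r) ^ DIM('a) + l powr (1 - p) * Lp_od_norm p F powr p)"
proof -
  let ?n = "DIM('a)"
  let ?w = "\<lambda>z::'a \<times> 'a. norm (F z) powr p / norm (fst z - snd z) ^ ?n"
  have w: "integrable lebesgue ?w" and Iw: "Lp_od_norm p F powr p = integral\<^sup>L lebesgue ?w"
  proof -
    show "integrable lebesgue ?w" using F by (simp add: Lp_od_def case_prod_beta')
    have "integral\<^sup>L lebesgue ?w \<ge> 0" by (intro integral_nonneg_AE) auto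
    then show "Lp_od_norm p F powr p = integral\<^sup>L lebesgue ?w"
      using p by (simp add: Lp_od_norm_def case_prod_beta' powr_powr)
  qed
  let ?g = "\<lambda>z. M * (l / (2 * r) ^ ?n * indicator E z + l powr (1 - p) * ?w z)"
  have iE: "integrable lebesgue (indicator E :: 'a \<times> 'a \<Rightarrow> real)"
    using E by (auto simp: fmeasurable_def)
  have ig: "integrable lebesgue ?g"
    by (intro integrable_mult_right Bochner_Integration.integrable_add iE w)
  have "norm (od_pairing F G) \<le> integral\<^sup>L lebesgue (\<lambda>z. norm (F z * G z / of_real (norm (fst z - snd z) ^ ?n)))"
    unfolding od_pairing_def case_prod_beta' by simp
  also have "\<dots> \<le> integral\<^sup>L lebesgue ?g"
  proof (rule integral_mono'[OF ig])
    fix z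
    show nonneg: "0 \<le> ?g z" using M l r by (intro mult_nonneg_nonneg add_nonneg_nonneg) auto
    show "norm (F z * G z / of_real (norm (fst z - snd z) ^ ?n)) \<le> ?g z"
    proof (cases "z \<in> E")
      case False
      then show ?thesis using G nonneg by simp
    next
      case True
      let ?d = "norm (fst z - snd z)"
      have "(2 * r) ^ ?n \<le> ?d ^ ?n" using apart[OF True] r by (intro power_mono) auto
      moreover have "(2 * r) ^ ?n > 0" using r by simp
      ultimately have d: "(2 * r) ^ ?n \<le> ?d ^ ?n" "(2 * r) ^ ?n > 0" .
      have "norm (F z * G z / of_real (?d ^ ?n)) = norm (G z) * norm (F z) / ?d ^ ?n"
        by (simp add: norm_mult norm_divide norm_power)
      also have "\<dots> \<le> M * (l + l powr (1 - p) * norm (F z) powr p) / ?d ^ ?n"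
        by (intro divide_right_mono mult_mono G True Young_cutoff) (use l p M in auto)
      also have "\<dots> = M * (l / ?d ^ ?n + l powr (1 - p) * ?w z)"
        by (simp add: field_simps add_divide_distrib)
      also have "\<dots> \<le> M * (l / (2 * r) ^ ?n + l powr (1 - p) * ?w z)"
        using d l M by (intro mult_left_mono add_right_mono divide_left_mono) auto
      finally show ?thesis using True by simp
    qed
  qed
  also have "\<dots> = M * (l / (2 * r) ^ ?n * measure lebesgue E + l powr (1 - p) * Lp_od_norm p F powr p)"
  proof -
    have "integral\<^sup>L lebesgue (\<lambda>z. l / (2 * r) ^ ?n * indicator E z + l powr (1 - p) * ?w z) =
        l / (2 * r) ^ ?n * integral\<^sup>L lebesgue (indicator E :: 'a \<times> 'a \<Rightarrow> real) + l powr (1 - p) * integral\<^sup>L lebesgue ?w"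
      by (subst Bochner_Integration.integral_add)
         (intro integrable_mult_right iE w, intro integrable_mult_right iE w, simp only: integral_mult_right_zero)
    then show ?thesis by (simp only: integral_mult_right_zero Iw) simp
  qed
  also have "\<dots> \<le> M * (l / (2 * r) ^ ?n * V + l powr (1 - p) * Lp_od_norm p F powr p)"
    using E M l r by (intro mult_left_mono add_right_mono) auto
  finally show ?thesis by simp
qed

lemma norm_le_in_cube:
  fixes x c :: "'a::euclidean_space"
  assumes "x \<in> cube c r" shows "norm (x - c) \<le> real DIM('a) * r"
proof -
  have "norm (x - c) \<le> (\<Sum>b\<in>Basis. \<bar>(x - c) \<bullet> b\<bar>)" by (rule norm_le_l1)
  also have "\<dots> \<le> (\<Sum>b\<in>(Basis::'a set). r)"
    using assms by (intro sum_mono) (auto simp: mem_cube inner_diff_left)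
  finally show ?thesis by simp
qed

lemma cube_Times: "cube c r \<times> cube d r = cbox (c - r *\<^sub>R One, d - r *\<^sub>R One) (c + r *\<^sub>R One, d + r *\<^sub>R One)"
  by (simp add: cube_def cbox_Pair_eq)

lemma measure_cube_Times:
  fixes c d :: "'a::euclidean_space"
  assumes "r \<ge> 0"
  shows "measure lebesgue (cube c r \<times> cube d r) = (2 * r) ^ (2 * DIM('a))"
proof -
  have "measure lebesgue (cube c r \<times> cube d r) = measure lborel (cube c r) * measure lborel (cube d r)"
    unfolding cube_Times unfolding cube_def by (simp add: content_Pair measure_completion)
  also have "\<dots> = (2 * r) ^ DIM('a) * (2 * r) ^ DIM('a)"
    using content_cube[OF assms, of c] content_cube[OF assms, of d] by (simp add: cube_def measure_completion)
  finally show ?thesis by (simp only: power_add mult_2[of "DIM('a)"])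
qed

lemma integral_norm_le_on_cube:
  fixes h :: "'a::euclidean_space \<Rightarrow> complex"
  assumes "r \<ge> 0" "\<And>x. x \<in> cube c r \<Longrightarrow> norm (h x) \<le> M" "\<And>x. x \<notin> cube c r \<Longrightarrow> h x = 0"
  shows "norm (integral\<^sup>L lebesgue h) \<le> M * (2 * r) ^ DIM('a)"
proof -
  have "c \<in> cube c r" using assms by (simp add: mem_cube)
  then have "M \<ge> 0" using assms(2) norm_ge_zero order_trans by blast
  have "cube c r \<in> lmeasurable" using compact_cube lmeasurable_compact by blast
  then have i: "integrable lebesgue (indicator (cube c r) :: 'a \<Rightarrow> real)" by (auto simp: fmeasurable_def)
  have "norm (integral\<^sup>L lebesgue h) \<le> integral\<^sup>L lebesgue (\<lambda>x. norm (h x))" by simp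
  also have "\<dots> \<le> integral\<^sup>L lebesgue (\<lambda>x. M * indicator (cube c r) x)"
  proof (rule integral_mono')
    show "integrable lebesgue (\<lambda>x. M * indicator (cube c r) x)" using i by (rule integrable_mult_right)
    show "norm (h x) \<le> M * indicator (cube c r) x" for x
      using assms by (cases "x \<in> cube c r") auto
    show "0 \<le> M * indicator (cube c r) x" for x using \<open>M \<ge> 0\<close> by simp
  qed
  also have "\<dots> = M * (2 * r) ^ DIM('a)" using i content_cube[OF assms(1), of c] by simp
  finally show ?thesis .
qed

section \<open>Averages of the distribution and their limit\<close>

definition bump_mass :: "'a::euclidean_space \<Rightarrow> real \<Rightarrow> real" where
  "bump_mass c r = integral\<^sup>L lebesgue (\<lambda>x. bump ((x - c) /\<^sub>R r))"

definition unit_bump :: "'a::euclidean_space \<Rightarrow> real \<Rightarrow> 'a \<Rightarrow> real" where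
  "unit_bump c r x = bump ((x - c) /\<^sub>R r) / bump_mass c r"

lemma mem_cube_rescale:
  assumes "r > 0" shows "(x - c) /\<^sub>R r \<in> cube 0 t \<longleftrightarrow> x \<in> cube c (t * r)"
  using assms by (simp add: mem_cube inner_diff_left abs_mult field_simps)

lemma bump_rescaled_eq_0: "r > 0 \<Longrightarrow> x \<notin> cube c r \<Longrightarrow> bump ((x - c) /\<^sub>R r) = 0"
  using mem_cube_rescale[of r x c 1] by (intro bump_eq_0) simp

lemma integrable_real_compact_support:
  fixes b :: "'a::euclidean_space \<Rightarrow> real"
  assumes "smooth b" "compact K" "\<And>x. x \<notin> K \<Longrightarrow> b x = 0"
  shows "integrable lebesgue b"
proof -
  have "integrable lebesgue (\<lambda>x. complex_of_real (b x))"
    by (intro integrable_schwartz schwartzI_compact_support[OF smooth_of_real[OF assms(1)] assms(2)])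
       (simp add: assms)
  then have "integrable lebesgue (\<lambda>x. Re (complex_of_real (b x)))" by (rule integrable_Re)
  then show ?thesis by simp
qed

text \<open>
  The bump equals one on the concentric cube of half the size. Together with \<open>bump \<le> 1\<close> this bounds
  bumps of unit mass at scale \<open>r\<close> by \<open>r\<^sup>-\<^sup>n\<close>.
\<close>

lemma bump_mass_ge:
  fixes c :: "'a::euclidean_space"
  assumes "r > 0" shows "bump_mass c r \<ge> r ^ DIM('a)"
proof -
  have "r ^ DIM('a) = integral\<^sup>L lebesgue (indicator (cube c (r / 2)) :: 'a \<Rightarrow> real)"
    using content_cube[of "r / 2" c] assms by simp
  also have "\<dots> \<le> bump_mass c r"
    unfolding bump_mass_def
  proof (rule integral_mono')
    show "integrable lebesgue (\<lambda>x. bump ((x - c) /\<^sub>R r))"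
      by (rule integrable_real_compact_support[OF smooth_bump_rescaled compact_cube bump_rescaled_eq_0[OF assms]])
    show "indicator (cube c (r / 2)) x \<le> bump ((x - c) /\<^sub>R r)" for x
      using mem_cube_rescale[OF assms, of x c "1/2"] bump_eq_1[of "(x - c) /\<^sub>R r"]
      by (auto simp: indicator_def bump_bounds)
  qed (rule bump_bounds)
  finally show ?thesis .
qed

lemma smooth_unit_bump: "smooth (unit_bump c r)"
  using smooth_cmult[OF smooth_bump_rescaled[where d = c and r = r], of "inverse (bump_mass c r)"]
  by (simp add: unit_bump_def[abs_def] divide_inverse mult.commute)

lemma unit_bump_eq_0: "r > 0 \<Longrightarrow> x \<notin> cube c r \<Longrightarrow> unit_bump c r x = 0"
  by (simp add: unit_bump_def bump_rescaled_eq_0)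

lemma unit_bump_bound:
  fixes c :: "'a::euclidean_space"
  assumes "r > 0" shows "\<bar>unit_bump c r x\<bar> \<le> 1 / r ^ DIM('a)"
  using bump_mass_ge[OF assms, of c] bump_bounds[of "(x - c) /\<^sub>R r"] assms
  by (auto simp: unit_bump_def abs_divide intro!: frac_le)

lemma integral_unit_bump: 
  fixes c :: "'a::euclidean_space"
  assumes "r > 0" shows "integral\<^sup>L lebesgue (unit_bump c r) = 1"
proof -
  have "bump_mass c r > 0" using bump_mass_ge[OF assms, of c] assms zero_less_power order_less_le_trans by blast
  then show ?thesis by (simp add: unit_bump_def[abs_def] bump_mass_def)
qed

text \<open>
  The constant of the two-bump estimate: points of the two cubes have distance at most \<open>6 n r\<close>, and
  the two summands of the second factor come from the two terms of \<open>od_pairing_bound\<close>.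
\<close>

definition bump_const :: "nat \<Rightarrow> real \<Rightarrow> real" where
  "bump_const n s = (6 * real n) powr (s + real n) * (2 * 2 ^ n + 1)"

text \<open>
  The errors made by halving the scale repeatedly form a geometric series of ratio \<open>2\<^sup>-\<^sup>\<alpha>\<close>, of which
  this is the sum.
\<close>

definition chain_const :: "nat \<Rightarrow> real \<Rightarrow> real \<Rightarrow> real" where
  "chain_const n s p = 2 * 2 ^ n * bump_const n s / (1 - 2 powr (- (s - real n / p)))"

lemma bump_const_nonneg: "bump_const n s \<ge> 0"
  by (simp add: bump_const_def)

text \<open>
  The dimension is a parameter \<open>n\<close> of its own, so that the constants are visibly functions of the
  numbers \<open>n\<close>, \<open>s\<close> and \<open>p\<close> alone.
\<close>

locale frac_gradient_in_Lp =
  fixes s p :: real and n :: nat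
    and u :: "('a::euclidean_space \<Rightarrow> complex) \<Rightarrow> complex" and F :: "'a \<times> 'a \<Rightarrow> complex"
  assumes s: "0 < s" and s1: "s < 1" and p: "p \<ge> 1" and sp: "s * p > real n" and n: "n = DIM('a)"
    and u: "tempered_distribution u" and F: "F \<in> Lp_od p"
    and grad: "od_represented_by (frac_grad s u) F"
begin

abbreviation \<alpha> :: real where "\<alpha> \<equiv> s - real n / p"
abbreviation N :: real where "N \<equiv> Lp_od_norm p F"

lemma N_nonneg: "N \<ge> 0" by (simp add: Lp_od_norm_def)

lemma \<alpha>_pos: "\<alpha> > 0" using sp p by (simp add: field_simps)

lemma n_pos: "n > 0" using n by simp

lemma u_add: "f \<in> schwartz \<Longrightarrow> g \<in> schwartz \<Longrightarrow> u (\<lambda>x. f x + g x) = u f + u g"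
  and u_cmult: "f \<in> schwartz \<Longrightarrow> u (\<lambda>x. c * f x) = c * u f"
  using u by (auto simp: tempered_distribution_def)

text \<open>
  This is the only place where the fractional gradient of \<open>u\<close> enters; all later estimates of \<open>u\<close> come
  from this identity.
\<close>

lemma two_bump_identity:
  fixes a :: "'a \<Rightarrow> complex" and b :: "'a \<Rightarrow> real"
  assumes a: "smooth a" "\<And>x. x \<notin> A \<Longrightarrow> a x = 0" and b: "smooth b" "\<And>x. x \<notin> B \<Longrightarrow> b x = 0"
    and AB: "compact A" "compact B" "A \<inter> B = {}"
  shows "of_real (integral\<^sup>L lebesgue b) * u a - integral\<^sup>L lebesgue a * u (\<lambda>x. of_real (b x)) =
     od_pairing F (od_test s a b)"
proof -
  have aS: "a \<in> schwartz" by (rule schwartzI_compact_support[OF a(1) AB(1) a(2)])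
  have bS: "(\<lambda>x. complex_of_real (b x)) \<in> schwartz"
    by (rule schwartzI_compact_support[OF smooth_of_real[OF b(1)] AB(2)]) (simp add: b)
  have cS: "(\<lambda>x. c * f x) \<in> schwartz"
    if "smooth f" "compact K" "\<And>x. x \<notin> K \<Longrightarrow> f x = 0" for c and f :: "'a \<Rightarrow> complex" and K
  proof (rule schwartzI_compact_support[OF _ that(2)])
    have "smooth (\<lambda>x. Re c *\<^sub>R f x + Im c *\<^sub>R (\<i> * f x))"
    proof (intro smooth_add smooth_cmult that(1))
      show "smooth (\<lambda>x. \<i> * f x)"
        using smooth_compose[OF smooth_bounded_linear[OF bounded_linear_mult_right[of \<i>]] that(1)] .
    qed
    also have "(\<lambda>x. Re c *\<^sub>R f x + Im c *\<^sub>R (\<i> * f x)) = (\<lambda>x. c * f x)"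
      by (auto simp: fun_eq_iff complex_eq_iff)
    finally show "smooth (\<lambda>x. c * f x)" .
  qed (simp add: that)
  have "od_pairing F (od_test s a b) = frac_grad s u (od_test s a b)"
    using grad od_test_schwartz_od[OF a b AB] by (simp add: od_represented_by_def)
  also have "\<dots> = u (\<lambda>x. of_real (integral\<^sup>L lebesgue b) * a x + (- integral\<^sup>L lebesgue a) * of_real (b x))"
  proof -
    have "a x = 0 \<or> b x = 0" for x using a(2) b(2) AB(3) by blast
    from frac_div_od_test[OF integrable_schwartz[OF aS] integrable_real_compact_support[OF b(1) AB(2) b(2)] this]
    show ?thesis by (simp add: frac_grad_def)
  qed
  also have "\<dots> = of_real (integral\<^sup>L lebesgue b) * u a + (- integral\<^sup>L lebesgue a) * u (\<lambda>x. of_real (b x))"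
  proof -
    have "(\<lambda>x. c * complex_of_real (b x)) \<in> schwartz" for c
      by (rule cS[OF smooth_of_real[OF b(1)] AB(2)]) (simp add: b)
    moreover have "(\<lambda>x. c * a x) \<in> schwartz" for c
      by (rule cS[OF a(1) AB(1)]) (simp add: a)
    ultimately show ?thesis
      by (simp only: u_add u_cmult[OF aS] u_cmult[OF bS])
  qed
  finally show ?thesis by simp
qed

text \<open>
  The test function is bounded by \<open>C A B r\<^sup>s\<^sup>+\<^sup>n\<close> on a set of measure comparable to \<open>r\<^sup>n\<close> with respect to
  \<open>\<bar>x - y\<bar>\<^sup>-\<^sup>n dx dy\<close>, since \<open>\<bar>x - y\<bar>\<close> is comparable to \<open>r\<close> there. The exponents add up to
  \<open>s + n + n (1 - 1/p) = 2 n + \<alpha>\<close>.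
\<close>

lemma two_bump_estimate:
  fixes a :: "'a \<Rightarrow> complex" and b :: "'a \<Rightarrow> real"
  assumes r: "r > 0"
    and a: "smooth a" "\<And>x. x \<notin> cube c r \<Longrightarrow> a x = 0" "\<And>x. norm (a x) \<le> A"
    and b: "smooth b" "\<And>x. x \<notin> cube d r \<Longrightarrow> b x = 0" "\<And>x. \<bar>b x\<bar> \<le> B"
    and sep: "e \<in> Basis" "4 * r \<le> \<bar>(c - d) \<bullet> e\<bar>" and close: "norm (c - d) \<le> 4 * real n * r"
  shows "norm (of_real (integral\<^sup>L lebesgue b) * u a - integral\<^sup>L lebesgue a * u (\<lambda>x. of_real (b x)))
    \<le> bump_const n s * A * B * r ^ (2 * n) * r powr \<alpha> * N"
proof -
  have A0: "A \<ge> 0" and B0: "B \<ge> 0" using a(3)[of 0] b(3)[of 0] norm_ge_zero[of "a 0"] by linarith+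
  define E where "E = cube c r \<times> cube d r \<union> cube d r \<times> cube c r"
  have coord: "\<bar>x \<bullet> e - c \<bullet> e\<bar> \<le> r" if "x \<in> cube c r" for x c using that sep by (simp add: mem_cube)
  have apart: "2 * r \<le> norm (x - y)" "norm (x - y) \<le> 6 * real n * r"
    if "x \<in> cube c r" "y \<in> cube d r" for x y
  proof -
    have "2 * r \<le> \<bar>(x - y) \<bullet> e\<bar>"
      using coord[OF that(1)] coord[OF that(2)] sep(2) unfolding inner_diff_left by linarith
    also have "\<dots> \<le> norm (x - y)" by (rule Basis_le_norm[OF sep(1)])
    finally show "2 * r \<le> norm (x - y)" .
    have "norm (x - y) \<le> norm (x - c) + norm (c - d) + norm (y - d)"
      using norm_triangle_ineq4[of "(x - c) + (c - d)" "y - d"] norm_triangle_ineq[of "x - c" "c - d"] by simp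
    also have "\<dots> \<le> real n * r + 4 * real n * r + real n * r"
      by (intro add_mono close) (use norm_le_in_cube that n in auto)
    finally show "norm (x - y) \<le> 6 * real n * r" by (simp add: algebra_simps)
  qed
  have apartE: "2 * r \<le> norm (fst z - snd z)" "norm (fst z - snd z) \<le> 6 * real n * r" if "z \<in> E" for z
    using that apart[of "fst z" "snd z"] apart[of "snd z" "fst z"]
    by (auto simp: E_def mem_Times_iff norm_minus_commute[of "fst z" "snd z"])
  have disj: "cube c r \<inter> cube d r = {}"
  proof (rule ccontr)
    assume "\<not> ?thesis"
    then obtain x where "x \<in> cube c r" "x \<in> cube d r" by blast
    then show False using apart(1)[of x x] r by simp
  qed
  define M where "M = (6 * real n * r) powr (s + real n) * (A * B)"
  have M0: "M \<ge> 0" using A0 B0 by (simp add: M_def)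
  have G: "norm (od_test s a b z) \<le> M" if "z \<in> E" for z
  proof -
    have "norm (od_test s a b z) = norm (fst z - snd z) powr (s + real n) / 2 *
       norm (b (snd z) *\<^sub>R a (fst z) - b (fst z) *\<^sub>R a (snd z))"
      by (simp add: od_test_def n)
    also have "\<dots> \<le> (6 * real n * r) powr (s + real n) / 2 * (A * B + A * B)"
    proof (intro mult_mono divide_right_mono powr_mono2)
      have "norm (b (snd z) *\<^sub>R a (fst z) - b (fst z) *\<^sub>R a (snd z)) \<le>
          \<bar>b (snd z)\<bar> * norm (a (fst z)) + \<bar>b (fst z)\<bar> * norm (a (snd z))"
        using norm_triangle_ineq4[of "b (snd z) *\<^sub>R a (fst z)" "b (fst z) *\<^sub>R a (snd z)"] by simp
      also have "\<dots> \<le> B * A + B * A"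
        by (intro add_mono mult_mono a b) (use A0 B0 in auto)
      finally show "norm (b (snd z) *\<^sub>R a (fst z) - b (fst z) *\<^sub>R a (snd z)) \<le> A * B + A * B"
        by (simp add: mult.commute)
    qed (use s apartE[OF that] in auto)
    finally show ?thesis by (simp add: M_def)
  qed
  have G0: "od_test s a b z = 0" if "z \<notin> E" for z
    using that a(2) b(2) by (cases z) (auto simp: E_def od_test_def)
  have Em: "E \<in> lmeasurable"
    unfolding E_def by (intro lmeasurable_compact compact_Un compact_Times compact_cube)
  have EV: "measure lebesgue E \<le> 2 * (2 * r) ^ (2 * n)"
  proof -
    have "measure lebesgue E \<le> measure lebesgue (cube c r \<times> cube d r) + measure lebesgue (cube d r \<times> cube c r)"
      unfolding E_def cube_Times by (intro measure_Un_le) auto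
    then show ?thesis using measure_cube_Times[of r c d] measure_cube_Times[of r d c] r n by (simp add: mult.commute)
  qed
  have bound: "norm (od_pairing F (od_test s a b)) \<le> bump_const n s * A * B * r ^ (2 * n) * r powr \<alpha> * N'"
    if N': "N' > N" for N'
  proof -
    have N'0: "N' > 0" using N_nonneg N' by linarith
    \<comment> \<open>With this choice both terms of the bound are of order N' r^(n - n/p). Working with N' > N keeps l positive when N = 0.\<close>
    define l where "l = N' * r powr (- real n / p)"
    have l0: "l > 0" using N'0 r by (simp add: l_def)
    let ?q = "r powr (real n - real n / p)"
    have vol: "l * (2 * (2 * r) ^ (2 * n)) / (2 * r) ^ n = 2 * 2 ^ n * N' * ?q"
    proof -
      have "(2 * r) ^ (2 * n) = (2 * r) ^ n * (2 * r) ^ n" by (simp only: mult_2 power_add)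
      then have "l * (2 * (2 * r) ^ (2 * n)) / (2 * r) ^ n = l * (2 * (2 * r) ^ n)"
        using r by simp
      also have "\<dots> = 2 * 2 ^ n * N' * (r powr (- real n / p) * r ^ n)"
        unfolding l_def power_mult_distrib by (simp only: mult_ac)
      also have "r powr (- real n / p) * r ^ n = ?q"
        using r by (simp add: powr_realpow[symmetric] powr_add[symmetric])
      finally show ?thesis .
    qed
    have mass: "l powr (1 - p) * N' powr p = N' * ?q"
    proof -
      have e1: "l powr (1 - p) = N' powr (1 - p) * r powr ((- real n / p) * (1 - p))"
        using N'0 r by (simp add: l_def powr_mult powr_powr)
      have e2: "(- real n / p) * (1 - p) = real n - real n / p" using p by (simp add: field_simps)
      have e3: "N' powr (1 - p) * N' powr p = N'" using N'0 by (simp add: powr_add[symmetric])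
      have "x * y * z = (x * z) * y" for x y z :: real by simp
      then show ?thesis unfolding e1 e2 by (simp only: e3)
    qed
    have q: "r powr (s + real n) * ?q = r ^ (2 * n) * r powr \<alpha>"
      using r by (simp add: powr_realpow[symmetric] powr_add[symmetric])
    have "norm (od_pairing F (od_test s a b)) \<le>
       M * (l * (2 * (2 * r) ^ (2 * n)) / (2 * r) ^ n + l powr (1 - p) * N powr p)"
      using od_pairing_bound[OF F p r l0 M0 Em EV apartE(1) G G0] n by simp
    also have "\<dots> \<le> M * (l * (2 * (2 * r) ^ (2 * n)) / (2 * r) ^ n + l powr (1 - p) * N' powr p)"
      using N' N_nonneg p M0 by (intro mult_left_mono add_left_mono powr_mono2) auto
    also have "\<dots> = M * (2 * 2 ^ n * N' * ?q + N' * ?q)" by (simp only: vol mass)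
    also have "\<dots> = (6 * real n) powr (s + real n) * (2 * 2 ^ n + 1) * A * B * (r powr (s + real n) * ?q) * N'"
    proof -
      have "(6 * real n * r) powr (s + real n) = (6 * real n) powr (s + real n) * r powr (s + real n)"
        using r by (simp add: powr_mult)
      then show ?thesis unfolding M_def by (simp only: distrib_left distrib_right mult_ac mult_1_left)
    qed
    also have "\<dots> = bump_const n s * A * B * r ^ (2 * n) * r powr \<alpha> * N'"
      unfolding q bump_const_def by (simp only: mult_ac)
    finally show ?thesis .
  qed
  \<comment> \<open>Let N' decrease to N.\<close>
  let ?K = "bump_const n s * A * B * r ^ (2 * n) * r powr \<alpha>"
  have "(\<lambda>k. ?K * (N + 1 / real (Suc k))) \<longlonglongrightarrow> ?K * (N + 0)"
    by (intro tendsto_intros LIMSEQ_Suc[OF lim_const_over_n])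
  then have "norm (od_pairing F (od_test s a b)) \<le> ?K * (N + 0)"
    by (rule LIMSEQ_le_const) (auto intro!: bound)
  then show ?thesis
    using two_bump_identity[OF a(1,2) b(1,2) compact_cube compact_cube disj] by simp
qed

definition average :: "'a \<Rightarrow> real \<Rightarrow> complex" where
  "average c r = u (\<lambda>x. of_real (unit_bump c r x))"

lemma apply_vs_distant_average:
  assumes r: "r > 0"
    and a: "smooth a" "\<And>x. x \<notin> cube c r \<Longrightarrow> a x = 0" "\<And>x. norm (a x) \<le> A"
    and sep: "e \<in> Basis" "4 * r \<le> \<bar>(c - d) \<bullet> e\<bar>" and close: "norm (c - d) \<le> 4 * real n * r"
  shows "norm (u a - integral\<^sup>L lebesgue a * average d r) \<le> bump_const n s * A * r ^ n * r powr \<alpha> * N"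
proof -
  have bound: "\<bar>unit_bump d r x\<bar> \<le> 1 / r ^ n" for x
    using unit_bump_bound[OF r, of d x] by (simp only: n)
  have "norm (of_real (integral\<^sup>L lebesgue (unit_bump d r)) * u a - integral\<^sup>L lebesgue a * u (\<lambda>x. of_real (unit_bump d r x)))
      \<le> bump_const n s * A * (1 / r ^ n) * r ^ (2 * n) * r powr \<alpha> * N"
    by (rule two_bump_estimate[OF r a(1) a(2) a(3) smooth_unit_bump unit_bump_eq_0[OF r] bound sep close])
  moreover have "(1 / r ^ n) * r ^ (2 * n) = r ^ n"
    using r by (simp add: mult_2[of n] power_add)
  then have "bump_const n s * A * (1 / r ^ n) * r ^ (2 * n) * r powr \<alpha> * N = bump_const n s * A * r ^ n * r powr \<alpha> * N"
    by (simp only: mult.assoc)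
  ultimately show ?thesis
    by (simp only: integral_unit_bump[OF r] average_def of_real_1 mult_1_left)
qed

text \<open>
  The two bumps may have different heights: that of the smaller one is up to \<open>2\<^sup>n r\<^sup>-\<^sup>n\<close>, whence the
  factor \<open>2\<^sup>n\<close>.
\<close>

lemma distant_averages:
  assumes r: "r > 0" "r / 2 \<le> r'" "r' \<le> r"
    and sep: "e \<in> Basis" "4 * r \<le> \<bar>(c - d) \<bullet> e\<bar>" and close: "norm (c - d) \<le> 4 * real n * r"
  shows "norm (average c r' - average d r) \<le> 2 ^ n * bump_const n s * r powr \<alpha> * N"
proof -
  have r': "r' > 0" using r by linarith
  have "cube c r' \<subseteq> cube c r" using r by (force simp: mem_cube)
  then have out: "complex_of_real (unit_bump c r' x) = 0" if "x \<notin> cube c r" for x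
    using unit_bump_eq_0[OF r', of x c] that by auto
  have "1 / r' ^ n \<le> 1 / (r / 2) ^ n"
    using r by (intro divide_left_mono power_mono) auto
  then have bd: "norm (complex_of_real (unit_bump c r' x)) \<le> 2 ^ n / r ^ n" for x
    using unit_bump_bound[OF r', of c x] n r by (simp add: power_divide)
  have "norm (u (\<lambda>x. of_real (unit_bump c r' x)) - integral\<^sup>L lebesgue (\<lambda>x. complex_of_real (unit_bump c r' x)) * average d r)
      \<le> bump_const n s * (2 ^ n / r ^ n) * r ^ n * r powr \<alpha> * N"
    by (rule apply_vs_distant_average[OF r(1) smooth_of_real[OF smooth_unit_bump] out bd sep close])
  moreover have "integral\<^sup>L lebesgue (\<lambda>x. complex_of_real (unit_bump c r' x)) = 1"
    using integral_unit_bump[OF r', of c] by simp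
  ultimately show ?thesis using r by (simp add: average_def mult_ac)
qed

lemma shifted_center:
  fixes c :: 'a
  assumes "r > 0"
  obtains e d :: 'a where "e \<in> Basis" "4 * r \<le> \<bar>(c - d) \<bullet> e\<bar>" "norm (c - d) \<le> 4 * real n * r"
proof -
  obtain e :: 'a where e: "e \<in> Basis" using nonempty_Basis by blast
  have "1 * r \<le> real n * r" using n_pos assms by (intro mult_right_mono) auto
  then show ?thesis using that[of e "c + (4 * r) *\<^sub>R e"] e assms by (simp add: inner_Basis)
qed

text \<open>
  Two bumps around the same centre overlap, so both are compared with a third one at distance
  \<open>4 r\<close>.
\<close>

lemma averages_comparable_scale:
  assumes r: "r > 0" "r / 2 \<le> r'" "r' \<le> r"
  shows "norm (average c r' - average c r) \<le> 2 * 2 ^ n * bump_const n s * r powr \<alpha> * N"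
proof -
  obtain e d where *: "e \<in> Basis" "4 * r \<le> \<bar>(c - d) \<bullet> e\<bar>" "norm (c - d) \<le> 4 * real n * r"
    using shifted_center[OF r(1)] .
  have "norm (average c r' - average d r) \<le> 2 ^ n * bump_const n s * r powr \<alpha> * N"
    using distant_averages[OF r *] .
  moreover have "norm (average c r - average d r) \<le> 2 ^ n * bump_const n s * r powr \<alpha> * N"
    using distant_averages[OF r(1) _ order_refl *] r by simp
  ultimately show ?thesis
    using norm_triangle_ineq4[of "average c r' - average d r" "average c r - average d r"] by simp
qed

text \<open>
  The average around the centre of the support of \<open>a\<close> is reached from a distant one.
\<close>

lemma apply_vs_average:
  assumes r: "r > 0"
    and a: "smooth a" "\<And>x. x \<notin> cube c r \<Longrightarrow> a x = 0" "\<And>x. norm (a x) \<le> A"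
  shows "norm (u a - integral\<^sup>L lebesgue a * average c r) \<le> (1 + 4 ^ n) * bump_const n s * A * r ^ n * r powr \<alpha> * N"
proof -
  obtain e d where *: "e \<in> Basis" "4 * r \<le> \<bar>(c - d) \<bullet> e\<bar>" "norm (c - d) \<le> 4 * real n * r"
    using shifted_center[OF r] .
  have 1: "norm (u a - integral\<^sup>L lebesgue a * average d r) \<le> bump_const n s * A * r ^ n * r powr \<alpha> * N"
    by (rule apply_vs_distant_average[OF r a *])
  have A0: "A \<ge> 0" using a(3) norm_ge_zero order_trans by blast
  have "norm (integral\<^sup>L lebesgue a * (average c r - average d r)) \<le> (A * (2 * r) ^ n) * (2 ^ n * bump_const n s * r powr \<alpha> * N)"
    unfolding norm_mult using integral_norm_le_on_cube[OF less_imp_le[OF r] a(3) a(2)] r A0 n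
    by (intro mult_mono distant_averages[OF r _ order_refl *]) auto
  also have "\<dots> = 4 ^ n * bump_const n s * A * r ^ n * r powr \<alpha> * N"
  proof -
    have "(2::real) ^ n * 2 ^ n = 4 ^ n" by (simp add: power_mult_distrib[symmetric])
    then show ?thesis by (simp add: power_mult_distrib mult_ac)
  qed
  finally have 2: "norm (integral\<^sup>L lebesgue a * (average c r - average d r)) \<le> 4 ^ n * bump_const n s * A * r ^ n * r powr \<alpha> * N" .
  have "u a - integral\<^sup>L lebesgue a * average c r = (u a - integral\<^sup>L lebesgue a * average d r) - integral\<^sup>L lebesgue a * (average c r - average d r)"
    by (simp add: algebra_simps)
  then show ?thesis
    using 1 2 norm_triangle_ineq4[of "u a - integral\<^sup>L lebesgue a * average d r" "integral\<^sup>L lebesgue a * (average c r - average d r)"]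
    by (simp add: algebra_simps)
qed

lemma two_powr_lt_1: "2 powr (- \<alpha>) < (1::real)"
  using powr_less_mono[of "- \<alpha>" 0 2] \<alpha>_pos by simp

lemma chain_const_step: "2 * 2 ^ n * bump_const n s + chain_const n s p * 2 powr (- \<alpha>) = chain_const n s p"
proof -
  have "c + c / (1 - q) * q = c / (1 - q)" if "q < 1" for c q :: real
    using that by (simp add: field_simps)
  from this[OF two_powr_lt_1] show ?thesis unfolding chain_const_def .
qed

lemma chain_const_nonneg: "chain_const n s p \<ge> 0"
  using two_powr_lt_1 bump_const_nonneg by (simp add: chain_const_def)

text \<open>
  Induction on the number of halvings that lead from \<open>r\<close> to \<open>r'\<close>. The constant is chosen so that
  one more halving reproduces it, as \<open>chain_const_step\<close> states.
\<close>

lemma averages_smaller_scale: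
  assumes "0 < r'" "r' \<le> r"
  shows "norm (average c r' - average c r) \<le> chain_const n s p * r powr \<alpha> * N"
proof -
  let ?C = "2 * 2 ^ n * bump_const n s" and ?K = "chain_const n s p"
  have CK: "?C \<le> ?K" using chain_const_step mult_nonneg_nonneg[OF chain_const_nonneg powr_ge_zero[of 2 "- \<alpha>"]] by linarith
  have step: "norm (average c r' - average c r) \<le> ?K * r powr \<alpha> * N"
    if "0 < r" "r / 2 \<le> r'" "r' \<le> r" for r r'
    by (rule order_trans[OF averages_comparable_scale[OF that]]) (intro mult_right_mono CK N_nonneg powr_ge_zero)
  have main: "norm (average c r' - average c r) \<le> ?K * r powr \<alpha> * N" if "0 < r" "r / 2 ^ Suc m \<le> r'" "r' \<le> r" for m r
    using that
  proof (induction m arbitrary: r)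
    case 0
    then show ?case using step by simp
  next
    case (Suc m)
    show ?case
    proof (cases "r / 2 \<le> r'")
      case False
      then have "norm (average c r' - average c (r / 2)) \<le> ?K * (r / 2) powr \<alpha> * N"
        using Suc.prems by (intro Suc.IH) (auto simp: field_simps)
      moreover have "norm (average c (r / 2) - average c r) \<le> ?C * r powr \<alpha> * N"
        using Suc.prems by (intro averages_comparable_scale) auto
      moreover have "(r / 2) powr t = 2 powr (- t) * r powr t" for t
        using Suc.prems by (simp add: powr_divide powr_minus field_simps)
      ultimately have "norm (average c r' - average c r) \<le> ?K * (2 powr (- \<alpha>) * r powr \<alpha>) * N + ?C * r powr \<alpha> * N"
        using norm_triangle_ineq[of "average c r' - average c (r / 2)" "average c (r / 2) - average c r"] by simp
      also have "\<dots> = (?C + ?K * 2 powr (- \<alpha>)) * r powr \<alpha> * N" by (simp add: algebra_simps)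
      finally show ?thesis unfolding chain_const_step .
    qed (use step Suc.prems in auto)
  qed
  have r: "r > 0" using assms by linarith
  obtain m where "r / r' < 2 ^ m" using real_arch_pow[of 2 "r / r'"] by auto
  then have "r < 2 ^ m * r'" using assms by (simp add: field_simps)
  also have "\<dots> \<le> 2 ^ Suc m * r'" using assms by simp
  finally have "r / 2 ^ Suc m \<le> r'" by (simp add: field_simps)
  from main[OF r this assms(2)] show ?thesis .
qed

text \<open>
  By \<open>average_near_value\<close> below, this limit controls the averages at all scales, not only at those of
  the sequence.
\<close>

definition f :: "'a \<Rightarrow> complex" where
  "f c = lim (\<lambda>k. average c (1 / real (Suc k)))"

lemma averages_tendsto: "(\<lambda>k. average c (1 / real (Suc k))) \<longlonglongrightarrow> f c"
proof -
  let ?X = "\<lambda>k. average c (1 / real (Suc k))" and ?K = "chain_const n s p"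
  have "Cauchy ?X"
  proof (rule metric_CauchyI)
    fix e :: real assume e: "e > 0"
    have "(\<lambda>k. 1 / real (Suc k)) \<longlonglongrightarrow> 0" by (rule LIMSEQ_Suc[OF lim_const_over_n])
    then have "(\<lambda>k. ?K * (1 / real (Suc k)) powr \<alpha> * N) \<longlonglongrightarrow> ?K * 0 powr \<alpha> * N"
      using \<alpha>_pos by (intro tendsto_intros tendsto_powr2) auto
    then have "eventually (\<lambda>k. ?K * (1 / real (Suc k)) powr \<alpha> * N < e / 2) sequentially"
      using e by (intro order_tendstoD(2)[of _ "?K * 0 powr \<alpha> * N"]) auto
    then obtain k0 where k0: "?K * (1 / real (Suc k0)) powr \<alpha> * N < e / 2"
      unfolding eventually_sequentially by blast
    have near: "dist (?X k) (?X k0) < e / 2" if "k \<ge> k0" for k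
    proof -
      have "norm (?X k - ?X k0) \<le> ?K * (1 / real (Suc k0)) powr \<alpha> * N"
        by (rule averages_smaller_scale) (use that in \<open>auto simp: field_simps\<close>)
      then show ?thesis using k0 by (simp add: dist_norm)
    qed
    show "\<exists>M. \<forall>m\<ge>M. \<forall>n\<ge>M. dist (?X m) (?X n) < e"
    proof (intro exI[of _ k0] allI impI)
      fix i j assume "k0 \<le> i" "k0 \<le> j"
      then have "dist (?X i) (?X k0) < e / 2" "dist (?X j) (?X k0) < e / 2" using near by auto
      then show "dist (?X i) (?X j) < e" by (rule dist_triangle_half_l)
    qed
  qed
  then show ?thesis unfolding f_def using Cauchy_convergent convergent_LIMSEQ_iff by blast
qed

lemma average_near_value:
  assumes "r > 0" shows "norm (f c - average c r) \<le> chain_const n s p * r powr \<alpha> * N"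
proof (rule LIMSEQ_le_const2)
  show "(\<lambda>k. norm (average c (1 / real (Suc k)) - average c r)) \<longlonglongrightarrow> norm (f c - average c r)"
    by (intro tendsto_intros averages_tendsto)
  obtain k0 where k0: "1 / r < real k0" using reals_Archimedean2 by blast
  have "1 / real (Suc k) \<le> r" if "k \<ge> k0" for k
  proof -
    have "1 / r \<le> real (Suc k)" using k0 that by linarith
    then show ?thesis using assms by (simp add: field_simps)
  qed
  then show "\<exists>k0. \<forall>k\<ge>k0. norm (average c (1 / real (Suc k)) - average c r) \<le> chain_const n s p * r powr \<alpha> * N"
    by (intro exI[of _ k0] allI impI averages_smaller_scale) auto
qed

definition L :: real where "L = (2 * chain_const n s p + 2 ^ n * bump_const n s) * N"

lemma L_nonneg: "L \<ge> 0"
  using chain_const_nonneg bump_const_nonneg N_nonneg by (simp add: L_def)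

lemma holder_bound: "norm (f x - f y) \<le> L * norm (x - y) powr \<alpha>"
proof (cases "x = y")
  case False
  define m where "m = Max ((\<lambda>b. \<bar>(x - y) \<bullet> b\<bar>) ` Basis)"
  have "m \<in> (\<lambda>b. \<bar>(x - y) \<bullet> b\<bar>) ` Basis" unfolding m_def by (rule Max_in) auto
  then obtain e where e: "e \<in> Basis" "m = \<bar>(x - y) \<bullet> e\<bar>" by blast
  have le: "\<bar>(x - y) \<bullet> b\<bar> \<le> m" if "b \<in> Basis" for b
    unfolding m_def using that by (intro Max_ge) auto
  have up: "norm (x - y) \<le> real n * m"
  proof -
    have "norm (x - y) \<le> (\<Sum>b\<in>Basis. \<bar>(x - y) \<bullet> b\<bar>)" by (rule norm_le_l1)
    also have "\<dots> \<le> (\<Sum>b\<in>(Basis::'a set). m)" by (intro sum_mono le)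
    finally show ?thesis using n by simp
  qed
  have mn: "m \<le> norm (x - y)" using e Basis_le_norm by simp
  have "m \<ge> 0" using e by simp
  moreover have "m \<noteq> 0" using up False by auto
  ultimately have m: "m > 0" by linarith
  \<comment> \<open>Then the largest coordinate difference is exactly 4 r, which is the separation that the two-bump estimate asks for.\<close>
  define r where "r = m / 4"
  have r: "r > 0" using m by (simp add: r_def)
  let ?R = "r powr \<alpha> * N"
  have 1: "norm (f x - average x r) \<le> chain_const n s p * ?R" "norm (f y - average y r) \<le> chain_const n s p * ?R"
    using average_near_value[OF r] by (auto simp: mult.assoc)
  have 2: "norm (average x r - average y r) \<le> 2 ^ n * bump_const n s * ?R"
    using distant_averages[OF r _ order_refl e(1)] r e up by (simp add: r_def mult.assoc)
  have "norm (f x - f y) \<le> norm (f x - average x r) + norm (average x r - average y r) + norm (f y - average y r)"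
    using norm_triangle_ineq4[of "(f x - average x r) + (average x r - average y r)" "f y - average y r"]
      norm_triangle_ineq[of "f x - average x r" "average x r - average y r"] by simp
  also have "\<dots> \<le> L * r powr \<alpha>" using 1 2 by (simp add: L_def algebra_simps)
  also have "\<dots> \<le> L * norm (x - y) powr \<alpha>"
    using mn r m \<alpha>_pos by (intro mult_left_mono powr_mono2 L_nonneg) (auto simp: r_def)
  finally show ?thesis .
qed simp

end

section \<open>The limit represents the distribution\<close>

text \<open>
  A difference of two translates of the smooth step, so that sums of integer translates telescope
  to one.
\<close>

definition tile :: "real \<Rightarrow> real" where
  "tile t = smooth_step (t + 1) - smooth_step t"

lemma smooth_tile: "smooth (\<lambda>t. tile (a + b * t))"
  unfolding tile_def
  using smooth_diff[OF smooth_compose[OF smooth_smooth_step smooth_affine_real[of "a + 1" b]]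
      smooth_compose[OF smooth_smooth_step smooth_affine_real[of a b]]]
  by (simp add: algebra_simps)

lemma tile_bounds: "0 \<le> tile t" "tile t \<le> 1"
  using smooth_step_bounds[of t] smooth_step_bounds[of "t + 1"] smooth_step_eq_1[of "t + 1"] smooth_step_eq_0[of t]
  by (cases "t \<ge> 0"; simp add: tile_def)+

lemma tile_eq_0: "\<bar>t\<bar> \<ge> 1 \<Longrightarrow> tile t = 0"
  by (cases "t \<ge> 0") (simp_all add: tile_def smooth_step_eq_1 smooth_step_eq_0)

lemma tile_sum:
  assumes "\<bar>t\<bar> \<le> real m"
  shows "(\<Sum>k\<in>{- int m..int m}. tile (t - real_of_int k)) = 1"
proof -
  have "(\<Sum>k\<in>{- int j..int j}. tile (t - real_of_int k)) =
      smooth_step (t + real j + 1) - smooth_step (t - real j)" for j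
  proof (induction j)
    case 0
    then show ?case by (simp add: tile_def)
  next
    case (Suc j)
    have "{- int (Suc j)..int (Suc j)} = insert (- int (Suc j)) (insert (int (Suc j)) {- int j..int j})"
      by auto
    then show ?case using Suc.IH by (simp add: tile_def algebra_simps)
  qed
  then show ?thesis using assms by (simp add: smooth_step_eq_1 smooth_step_eq_0)
qed

definition grid :: "nat \<Rightarrow> ('a::euclidean_space \<Rightarrow> int) set" where
  "grid m = Basis \<rightarrow>\<^sub>E {- int m..int m}"

definition grid_point :: "real \<Rightarrow> ('a::euclidean_space \<Rightarrow> int) \<Rightarrow> 'a" where
  "grid_point r k = (\<Sum>b\<in>Basis. (r * real_of_int (k b)) *\<^sub>R b)"

definition cell_bump :: "real \<Rightarrow> ('a::euclidean_space \<Rightarrow> int) \<Rightarrow> 'a \<Rightarrow> real" where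
  "cell_bump r k x = (\<Prod>b\<in>Basis. tile (x \<bullet> b / r - real_of_int (k b)))"

lemma finite_grid: "finite (grid m)"
  unfolding grid_def by (intro finite_PiE) auto

lemma card_grid: "card (grid m :: ('a::euclidean_space \<Rightarrow> int) set) = (2 * m + 1) ^ DIM('a)"
  by (simp add: grid_def card_PiE nat_add_distrib nat_mult_distrib)

lemma smooth_cell_bump: "smooth (cell_bump r k)"
  unfolding cell_bump_def
proof (rule smooth_prod)
  fix b :: 'a
  have "smooth (\<lambda>x. tile ((- real_of_int (k b)) + (1 / r) * (x \<bullet> b)))"
    by (rule smooth_compose[OF smooth_tile smooth_bounded_linear[OF bounded_linear_inner_left]])
  then show "smooth (\<lambda>x. tile (x \<bullet> b / r - real_of_int (k b)))" by simp
qed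

lemma cell_bump_bounds: "0 \<le> cell_bump r k x" "cell_bump r k x \<le> 1"
  by (auto simp: cell_bump_def tile_bounds intro: prod_nonneg prod_le_1)

lemma cell_bump_eq_0:
  assumes "r > 0" "x \<notin> cube (grid_point r k) r"
  shows "cell_bump r k x = 0"
proof -
  have "grid_point r k \<bullet> b = r * real_of_int (k b)" if "b \<in> Basis" for b :: 'a
    unfolding grid_point_def using that by simp
  then obtain b where b: "b \<in> Basis" "r < \<bar>x \<bullet> b - r * real_of_int (k b)\<bar>"
    using assms(2) by (force simp: mem_cube not_le)
  have "x \<bullet> b / r - real_of_int (k b) = (x \<bullet> b - r * real_of_int (k b)) / r"
    using assms(1) by (simp add: field_simps)
  then have "1 \<le> \<bar>x \<bullet> b / r - real_of_int (k b)\<bar>" using b assms(1) by simp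
  then show ?thesis using b(1) unfolding cell_bump_def
    by (intro prod_zero bexI[of _ b]) (auto intro: tile_eq_0)
qed

lemma cell_bump_sum:
  fixes x :: "'a::euclidean_space"
  assumes "r > 0" "x \<in> cube 0 (real m * r)"
  shows "(\<Sum>k\<in>grid m. cell_bump r k x) = 1"
proof -
  have "(\<Sum>k\<in>grid m. cell_bump r k x) =
      (\<Prod>b\<in>Basis. \<Sum>j\<in>{- int m..int m}. tile (x \<bullet> b / r - real_of_int j))"
    unfolding grid_def cell_bump_def by (rule prod_sum_PiE[symmetric]) auto
  also have "\<dots> = 1"
  proof (rule prod.neutral, rule ballI, rule tile_sum)
    fix b :: 'a assume "b \<in> Basis"
    then have "\<bar>x \<bullet> b\<bar> \<le> real m * r" using assms(2) by (auto simp: mem_cube)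
    then show "\<bar>x \<bullet> b / r\<bar> \<le> real m" using assms(1) by (simp add: field_simps)
  qed
  finally show ?thesis .
qed

context frac_gradient_in_Lp
begin

lemma u_sum:
  assumes "finite I" "compact K" "\<And>i. i \<in> I \<Longrightarrow> smooth (g i)" "\<And>i x. i \<in> I \<Longrightarrow> x \<notin> K \<Longrightarrow> g i x = 0"
  shows "u (\<lambda>x. \<Sum>i\<in>I. g i x) = (\<Sum>i\<in>I. u (g i))"
  using assms(1,3,4)
proof (induction I)
  case empty
  have "(\<lambda>x. 0) \<in> schwartz" by (rule schwartzI_compact_support[of _ "{}"]) auto
  from u_cmult[OF this, of 0] show ?case by simp
next
  case (insert i I)
  have "g i \<in> schwartz"
    by (rule schwartzI_compact_support[OF _ assms(2)]) (use insert in auto)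
  moreover have "(\<lambda>x. \<Sum>i\<in>I. g i x) \<in> schwartz"
    by (rule schwartzI_compact_support[OF smooth_sum assms(2)]) (use insert in auto)
  ultimately show ?case using insert u_add by simp
qed

lemma continuous_f: "continuous_on UNIV f"
  unfolding continuous_on_def
proof (intro ballI)
  fix x :: 'a
  have "((\<lambda>y. L * norm (y - x) powr \<alpha>) \<longlongrightarrow> L * norm (x - x) powr \<alpha>) (at x)"
    using \<alpha>_pos by (intro tendsto_intros tendsto_powr2) auto
  then have "((\<lambda>y. L * norm (y - x) powr \<alpha>) \<longlongrightarrow> 0) (at x)" by simp
  then have "((\<lambda>y. f y - f x) \<longlongrightarrow> 0) (at x)"
    by (rule Lim_null_comparison[rotated]) (simp add: holder_bound)
  then show "(f \<longlongrightarrow> f x) (at x within UNIV)" using LIM_zero_cancel by auto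
qed

text \<open>
  As \<open>\<alpha> \<le> 1\<close>, Hoelder continuity implies growth that is at most linear, which makes \<open>f\<close> integrable
  against Schwartz functions.
\<close>

lemma linear_growth_f: "norm (f x) \<le> (norm (f 0) + L) * (1 + norm x)"
proof -
  have "real n / p \<ge> 0" using p by simp
  then have \<alpha>1: "\<alpha> \<le> 1" using s1 by linarith
  have pow: "norm x powr \<alpha> \<le> 1 + norm x"
  proof (cases "norm x \<le> 1")
    case True
    then have "norm x powr \<alpha> \<le> 1 powr \<alpha>" using \<alpha>_pos by (intro powr_mono2) auto
    then show ?thesis by (simp add: add_increasing2)
  next
    case False
    then have "norm x powr \<alpha> \<le> norm x powr 1" using \<alpha>1 by (intro powr_mono) auto
    then show ?thesis by simp
  qed
  have "norm (f x) \<le> norm (f 0) + norm (f x - f 0)" using norm_triangle_sub by blast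
  also have "\<dots> \<le> norm (f 0) + L * norm (x - 0) powr \<alpha>" by (intro add_left_mono holder_bound)
  also have "\<dots> \<le> norm (f 0) * (1 + norm x) + L * (1 + norm x)"
    using pow by (intro add_mono mult_left_mono L_nonneg) (auto simp: algebra_simps)
  finally show ?thesis by (simp add: algebra_simps)
qed

lemma integrable_f_schwartz: "\<phi> \<in> schwartz \<Longrightarrow> integrable lebesgue (\<lambda>x. f x * \<phi> x)"
  by (rule integrable_times_schwartz[OF continuous_f linear_growth_f])

definition cell_const :: real where
  "cell_const = (1 + 4 ^ n) * bump_const n s * N + chain_const n s p * N * 2 ^ n + L * real n powr \<alpha> * 2 ^ n"

text \<open>
  Both \<open>u a\<close> and \<open>\<integral>f a\<close> are compared with \<open>f c \<integral>a\<close>, the former through the average of \<open>u\<close> around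
  \<open>c\<close> at scale \<open>r\<close>.
\<close>

lemma cell_error:
  assumes r: "r > 0" and a: "smooth a" "\<And>x. x \<notin> cube c r \<Longrightarrow> a x = 0" "\<And>x. norm (a x) \<le> A"
  shows "norm (u a - integral\<^sup>L lebesgue (\<lambda>x. f x * a x)) \<le> cell_const * A * r ^ n * r powr \<alpha>"
proof -
  have A0: "A \<ge> 0" using a(3) norm_ge_zero order_trans by blast
  have aS: "a \<in> schwartz" by (rule schwartzI_compact_support[OF a(1) compact_cube a(2)])
  let ?I = "integral\<^sup>L lebesgue a"
  have 1: "norm (u a - ?I * average c r) \<le> (1 + 4 ^ n) * bump_const n s * A * r ^ n * r powr \<alpha> * N"
    by (rule apply_vs_average[OF r a])
  have I: "norm ?I \<le> A * (2 * r) ^ n"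
    using integral_norm_le_on_cube[OF less_imp_le[OF r] a(3) a(2)] n by simp
  have 2: "norm (?I * (f c - average c r)) \<le> A * (2 * r) ^ n * (chain_const n s p * r powr \<alpha> * N)"
    unfolding norm_mult by (intro mult_mono I average_near_value[OF r]) (use A0 r in auto)
  have 3: "norm (integral\<^sup>L lebesgue (\<lambda>x. (f c - f x) * a x)) \<le> (L * (real n * r) powr \<alpha> * A) * (2 * r) ^ DIM('a)"
  proof (rule integral_norm_le_on_cube[OF less_imp_le[OF r]])
    fix x assume x: "x \<in> cube c r"
    have "norm (f c - f x) \<le> L * norm (c - x) powr \<alpha>" by (rule holder_bound)
    also have "\<dots> \<le> L * (real n * r) powr \<alpha>"
      using norm_le_in_cube[OF x] \<alpha>_pos n
      by (intro mult_left_mono powr_mono2 L_nonneg) (auto simp: norm_minus_commute)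
    finally show "norm ((f c - f x) * a x) \<le> L * (real n * r) powr \<alpha> * A"
      unfolding norm_mult by (intro mult_mono a) (use L_nonneg in auto)
  qed (simp add: a)
  have split: "integral\<^sup>L lebesgue (\<lambda>x. (f c - f x) * a x) = f c * ?I - integral\<^sup>L lebesgue (\<lambda>x. f x * a x)"
    unfolding left_diff_distrib
    by (subst Bochner_Integration.integral_diff) (auto intro: integrable_f_schwartz aS integrable_schwartz)
  have eq: "u a - integral\<^sup>L lebesgue (\<lambda>x. f x * a x) =
      ((u a - ?I * average c r) - ?I * (f c - average c r)) + integral\<^sup>L lebesgue (\<lambda>x. (f c - f x) * a x)"
    unfolding split by (simp add: algebra_simps)
  have "norm (u a - integral\<^sup>L lebesgue (\<lambda>x. f x * a x)) \<le>
      norm (u a - ?I * average c r) + norm (?I * (f c - average c r)) + norm (integral\<^sup>L lebesgue (\<lambda>x. (f c - f x) * a x))"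
    unfolding eq
    using norm_triangle_ineq[of "(u a - ?I * average c r) - ?I * (f c - average c r)" "integral\<^sup>L lebesgue (\<lambda>x. (f c - f x) * a x)"]
      norm_triangle_ineq4[of "u a - ?I * average c r" "?I * (f c - average c r)"] by linarith
  also have "\<dots> \<le> (1 + 4 ^ n) * bump_const n s * A * r ^ n * r powr \<alpha> * N +
      A * (2 * r) ^ n * (chain_const n s p * r powr \<alpha> * N) + (L * (real n * r) powr \<alpha> * A) * (2 * r) ^ n"
    by (intro add_mono 1 2 3[folded n])
  also have "\<dots> = cell_const * A * r ^ n * r powr \<alpha>"
  proof -
    have "(real n * r) powr \<alpha> = real n powr \<alpha> * r powr \<alpha>" using r by (simp add: powr_mult)
    then show ?thesis
      unfolding cell_const_def power_mult_distrib by (simp only: distrib_left distrib_right mult_ac)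
  qed
  finally show ?thesis .
qed

text \<open>
  At scale \<open>r = R / (m + 1)\<close> the support of \<open>\<phi>\<close> is covered by at most \<open>(3 R / r)\<^sup>n\<close> cells, each of
  which contributes an error \<open>O(r\<^sup>n\<^sup>+\<^sup>\<alpha>)\<close>.
\<close>

lemma representation_compact_support:
  assumes \<phi>: "smooth \<phi>" "\<And>x. x \<notin> cube 0 R \<Longrightarrow> \<phi> x = 0" and R: "R > 0"
  shows "u \<phi> = integral\<^sup>L lebesgue (\<lambda>x. f x * \<phi> x)"
proof -
  obtain A where "\<And>x. \<bar>1::real\<bar> * norm (iter_partial [] \<phi> x) \<le> A"
    using iter_partial_bounded[OF \<phi>(1) compact_cube[of 0 R] \<phi>(2), where w = "\<lambda>x. 1" and bs = "[]"] by auto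
  then have A: "\<And>x. norm (\<phi> x) \<le> A" by simp
  then have A0: "A \<ge> 0" using norm_ge_zero order_trans by blast
  let ?E = "norm (u \<phi> - integral\<^sup>L lebesgue (\<lambda>x. f x * \<phi> x))"
  have C0: "cell_const \<ge> 0"
    using N_nonneg L_nonneg bump_const_nonneg chain_const_nonneg by (simp add: cell_const_def)
  have bound: "?E \<le> (3 * R) ^ n * cell_const * A * (R / real (Suc m)) powr \<alpha>" for m
  proof -
    let ?M = "Suc m"
    define r where "r = R / real ?M"
    have r: "r > 0" and Mr: "real ?M * r = R" using R by (auto simp: r_def)
    define a where "a k x = cell_bump r k x *\<^sub>R \<phi> x" for k x
    have a: "smooth (a k)" "\<And>x. x \<notin> cube (grid_point r k) r \<Longrightarrow> a k x = 0" "\<And>x. norm (a k x) \<le> A"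
      "\<And>x. x \<notin> cube 0 R \<Longrightarrow> a k x = 0" for k
    proof -
      show "smooth (a k)" unfolding a_def by (intro smooth_scaleR smooth_cell_bump \<phi>)
      show "a k x = 0" if "x \<notin> cube (grid_point r k) r" for x
        using cell_bump_eq_0[OF r that] by (simp add: a_def)
      show "norm (a k x) \<le> A" for x
      proof -
        have "norm (a k x) \<le> 1 * norm (\<phi> x)"
          unfolding a_def norm_scaleR using cell_bump_bounds[of r k x] by (intro mult_right_mono) auto
        then show ?thesis using A[of x] by simp
      qed
      show "a k x = 0" if "x \<notin> cube 0 R" for x using \<phi>(2)[OF that] by (simp add: a_def)
    qed
    have aS: "a k \<in> schwartz" for k by (rule schwartzI_compact_support[OF a(1) compact_cube a(4)])
    have sum: "\<phi> = (\<lambda>x. \<Sum>k\<in>grid ?M. a k x)"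
    proof
      fix x
      show "\<phi> x = (\<Sum>k\<in>grid ?M. a k x)"
      proof (cases "x \<in> cube 0 R")
        case True
        then have "(\<Sum>k\<in>grid ?M. cell_bump r k x) = 1"
          using cell_bump_sum[OF r, of x ?M] Mr by simp
        then show ?thesis unfolding a_def by (simp add: scaleR_left.sum[symmetric])
      next
        case False
        then show ?thesis using \<phi>(2) a(4) by simp
      qed
    qed
    have u\<phi>: "u \<phi> = (\<Sum>k\<in>grid ?M. u (a k))"
      by (subst sum) (rule u_sum[OF finite_grid compact_cube[of 0 R] a(1) a(4)])
    have i\<phi>: "integral\<^sup>L lebesgue (\<lambda>x. f x * \<phi> x) = (\<Sum>k\<in>grid ?M. integral\<^sup>L lebesgue (\<lambda>x. f x * a k x))"
      by (subst sum) (simp add: sum_distrib_left Bochner_Integration.integral_sum integrable_f_schwartz[OF aS])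
    have "?E \<le> (\<Sum>k\<in>grid ?M. norm (u (a k) - integral\<^sup>L lebesgue (\<lambda>x. f x * a k x)))"
      unfolding u\<phi> i\<phi> sum_subtractf[symmetric] by (rule norm_sum)
    also have "\<dots> \<le> (\<Sum>k\<in>(grid ?M :: ('a \<Rightarrow> int) set). cell_const * A * r ^ n * r powr \<alpha>)"
      by (intro sum_mono cell_error[OF r a(1,2,3)])
    also have "\<dots> = ((2 * real ?M + 1) * r) ^ n * (cell_const * A * r powr \<alpha>)"
      by (simp add: card_grid n power_mult_distrib)
    also have "\<dots> \<le> (3 * R) ^ n * (cell_const * A * r powr \<alpha>)"
    proof (intro mult_right_mono power_mono)
      have "(2 * real ?M + 1) * r \<le> (3 * real ?M) * r" using r by (intro mult_right_mono) auto
      also have "\<dots> = 3 * R" by (simp only: mult.assoc Mr)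
      finally show "(2 * real ?M + 1) * r \<le> 3 * R" .
    qed (use r A0 C0 in auto)
    finally show ?thesis by (simp add: r_def mult.assoc)
  qed
  have "(\<lambda>m. R / real (Suc m)) \<longlonglongrightarrow> 0" by (rule LIMSEQ_Suc[OF lim_const_over_n])
  then have "(\<lambda>m. (3 * R) ^ n * cell_const * A * (R / real (Suc m)) powr \<alpha>) \<longlonglongrightarrow> (3 * R) ^ n * cell_const * A * 0 powr \<alpha>"
    using \<alpha>_pos R by (intro tendsto_intros tendsto_powr2) auto
  then have "?E \<le> (3 * R) ^ n * cell_const * A * 0 powr \<alpha>"
    by (rule LIMSEQ_le_const) (use bound in blast)
  then show ?thesis by simp
qed

lemma represented_by_f: "represented_by u f"
  unfolding represented_by_def
proof (intro ballI conjI)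
  fix \<phi> :: "'a \<Rightarrow> complex" assume \<phi>: "\<phi> \<in> schwartz"
  show i: "integrable lebesgue (\<lambda>x. f x * \<phi> x)" by (rule integrable_f_schwartz[OF \<phi>])
  have "u (\<lambda>x. cutoff k x *\<^sub>R \<phi> x) = integral\<^sup>L lebesgue (\<lambda>x. f x * (cutoff k x *\<^sub>R \<phi> x))" for k
    by (rule representation_compact_support[where R = "real (Suc k)"])
       (auto intro: smooth_scaleR smooth_cutoff schwartz_smooth \<phi> simp: cutoff_eq_0)
  then have "(\<lambda>k. u (\<lambda>x. cutoff k x *\<^sub>R \<phi> x)) \<longlonglongrightarrow> integral\<^sup>L lebesgue (\<lambda>x. f x * \<phi> x)"
    using integral_cutoff_tendsto[OF i] by simp
  then show "u \<phi> = integral\<^sup>L lebesgue (\<lambda>x. f x * \<phi> x)"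
    using tempered_distribution_cutoff_tendsto[OF u \<phi>] LIMSEQ_unique by blast
qed

lemma holder_quotient_le: "q \<in> holder_quotients \<alpha> f \<Longrightarrow> q \<le> L"
proof -
  assume "q \<in> holder_quotients \<alpha> f"
  then obtain x y :: 'a where "x \<noteq> y" "q = norm (f x - f y) / norm (x - y) powr \<alpha>"
    unfolding holder_quotients_def by blast
  then show "q \<le> L" using holder_bound[of x y] by (simp add: divide_le_eq)
qed

lemma holder_continuous_f: "holder_continuous \<alpha> f"
  unfolding holder_continuous_def by (intro conjI continuous_f bdd_aboveI[of _ L] holder_quotient_le)

lemma holder_seminorm_f: "holder_seminorm \<alpha> f \<le> L"
  unfolding holder_seminorm_def
proof (rule cSup_least)
  obtain e :: 'a where "e \<in> Basis" using nonempty_Basis by blast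
  then have "e \<noteq> 0" by (rule nonzero_Basis)
  then show "holder_quotients \<alpha> f \<noteq> {}" unfolding holder_quotients_def by blast
qed (rule holder_quotient_le)

end

theorem theorem5p1:
  fixes s p :: real
  assumes "0 < s" and "s < 1" and "p \<ge> 1" and "s * p > real CARD('n::finite)"
  shows "\<exists>C>0. \<forall>u :: (real ^ 'n \<Rightarrow> complex) \<Rightarrow> complex. tempered_distribution u \<longrightarrow>
           (\<forall>F \<in> Lp_od p. od_represented_by (frac_grad s u) F \<longrightarrow>
              (\<exists>f. represented_by u f \<and>
                   holder_continuous (s - real CARD('n) / p) f \<and>
                   holder_seminorm (s - real CARD('n) / p) f \<le> C * Lp_od_norm p F))"
proof -
  let ?n = "CARD('n)"
  let ?C = "2 * chain_const ?n s p + 2 ^ ?n * bump_const ?n s"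
  have "\<exists>f. represented_by u f \<and> holder_continuous (s - real ?n / p) f \<and>
      holder_seminorm (s - real ?n / p) f \<le> (\<bar>?C\<bar> + 1) * Lp_od_norm p F"
    if "tempered_distribution u" "F \<in> Lp_od p" "od_represented_by (frac_grad s u) F"
    for u :: "(real ^ 'n \<Rightarrow> complex) \<Rightarrow> complex" and F
  proof -
    interpret frac_gradient_in_Lp s p ?n u F
      using assms that by unfold_locales auto
    have "L \<le> (\<bar>?C\<bar> + 1) * N" unfolding L_def by (intro mult_right_mono N_nonneg) linarith
    then show ?thesis
      using represented_by_f holder_continuous_f holder_seminorm_f by (intro exI[of _ f]) linarith
  qed
  then show ?thesis by (intro exI[of _ "\<bar>?C\<bar> + 1"]) auto
qed

end
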